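(* Let $B$ be a Hopf algebra and $A$ a finite dimensional bialgebra over a field $k$. If $B$ covers $A$, i.e. if there exist a $k$-coalgebra $C$ and a covering $f\colon B\otimes C\to A$, then $A$ is a Hopf algebra (that is, $A$ has an antipode).
   Context: Let $A,B$ be bialgebras and $C$ a coalgebra over the field $k$. A linear map $f\colon B\otimes C\to A$ is a measuring if for all $b,b'\in B$, $c\in C$: $f(bb'\otimes c)=\sum_{(c)}f(b\otimes c_1)f(b'\otimes c_2)$ and $f(1\otimes c)=\varepsilon(c)1_A$. A partial covering is a measuring $f\colon B\otimes C\to A$ that is also a coalgebra map, where $B\otimes C$ has the tensor product coalgebra structure. A covering is a surjective partial covering. Sweedler notation $\Delta(c)=\sum_{(c)}c_1\otimes c_2$ is used. *)

theory Defs
  imports "HOL-Algebra.Module" "HOL-Algebra.AbelCoset"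
begin

section \<open>Linear algebra\<close>

definition linear_maps ::
  "('k, 'm) ring_scheme \<Rightarrow> ('k, 'v, 'x) module_scheme \<Rightarrow> ('k, 'w, 'y) module_scheme \<Rightarrow> ('v \<Rightarrow> 'w) set"
  where "linear_maps k V W =
    {h \<in> carrier V \<rightarrow> carrier W.
       (\<forall>x\<in>carrier V. \<forall>y\<in>carrier V. h (x \<oplus>\<^bsub>V\<^esub> y) = h x \<oplus>\<^bsub>W\<^esub> h y) \<and>
       (\<forall>a\<in>carrier k. \<forall>x\<in>carrier V. h (a \<odot>\<^bsub>V\<^esub> x) = a \<odot>\<^bsub>W\<^esub> h x)}"

definition linear_span ::
  "('k, 'm) ring_scheme \<Rightarrow> ('k, 'v, 'x) module_scheme \<Rightarrow> 'v set \<Rightarrow> 'v set"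
  where "linear_span k V S = \<Inter>{H. submodule H k V \<and> S \<subseteq> H}"

definition finite_dimensional ::
  "('k, 'm) ring_scheme \<Rightarrow> ('k, 'v, 'x) module_scheme \<Rightarrow> bool"
  where "finite_dimensional k V \<longleftrightarrow>
    (\<exists>S. finite S \<and> S \<subseteq> carrier V \<and> linear_span k V S = carrier V)"

definition scalar_module :: "('k, 'm) ring_scheme \<Rightarrow> ('k, 'k) module"
  where "scalar_module k =
    \<lparr>carrier = carrier k, mult = mult k, one = one k, zero = zero k, add = add k,
     smult = mult k\<rparr>"

text \<open>Records of type \<open>module\<close> extend rings; the ring multiplication and unit of a
  module that is not an algebra play no role and are left unspecified.\<close>

definition quotient_module ::
  "('k, 'v, 'x) module_scheme \<Rightarrow> 'v set \<Rightarrow> ('k, 'v set) module"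
  where "quotient_module V N =
    \<lparr>carrier = a_rcosets\<^bsub>V\<^esub> N, mult = undefined, one = undefined, zero = N, add = set_add V,
     smult = (\<lambda>a X. \<Union>x\<in>X. N +>\<^bsub>V\<^esub> (a \<odot>\<^bsub>V\<^esub> x))\<rparr>"

definition free_module :: "('k, 'm) ring_scheme \<Rightarrow> 'i set \<Rightarrow> ('k, 'i \<Rightarrow> 'k) module"
  where "free_module k I =
    \<lparr>carrier = {u. (\<forall>i\<in>I. u i \<in> carrier k) \<and> (\<forall>i. i \<notin> I \<longrightarrow> u i = \<zero>\<^bsub>k\<^esub>)
                     \<and> finite {i. u i \<noteq> \<zero>\<^bsub>k\<^esub>}},
     mult = undefined, one = undefined,
     zero = (\<lambda>i. \<zero>\<^bsub>k\<^esub>), add = (\<lambda>u v i. u i \<oplus>\<^bsub>k\<^esub> v i), smult = (\<lambda>a u i. a \<otimes>\<^bsub>k\<^esub> u i)\<rparr>"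

definition free_gen :: "('k, 'm) ring_scheme \<Rightarrow> 'i \<Rightarrow> 'i \<Rightarrow> 'k"
  where "free_gen k i = (\<lambda>j. if j = i then \<one>\<^bsub>k\<^esub> else \<zero>\<^bsub>k\<^esub>)"


section \<open>Tensor products\<close>

text \<open>\<open>V \<otimes> W\<close> is the free module on \<open>V \<times> W\<close> modulo the bilinearity relations, so a tensor
  is a coset of formal linear combinations of pairs.\<close>

definition tensor_relations ::
  "('k, 'm) ring_scheme \<Rightarrow> ('k, 'v, 'x) module_scheme \<Rightarrow> ('k, 'w, 'y) module_scheme
    \<Rightarrow> ('v \<times> 'w \<Rightarrow> 'k) set"
  where "tensor_relations k V W =
    (let F = free_module k (carrier V \<times> carrier W); d = (\<lambda>v w. free_gen k (v, w)) in
     linear_span k F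
      ({d (v \<oplus>\<^bsub>V\<^esub> v') w \<ominus>\<^bsub>F\<^esub> (d v w \<oplus>\<^bsub>F\<^esub> d v' w) | v v' w.
          v \<in> carrier V \<and> v' \<in> carrier V \<and> w \<in> carrier W} \<union>
       {d v (w \<oplus>\<^bsub>W\<^esub> w') \<ominus>\<^bsub>F\<^esub> (d v w \<oplus>\<^bsub>F\<^esub> d v w') | v w w'.
          v \<in> carrier V \<and> w \<in> carrier W \<and> w' \<in> carrier W} \<union>
       {d (a \<odot>\<^bsub>V\<^esub> v) w \<ominus>\<^bsub>F\<^esub> (a \<odot>\<^bsub>F\<^esub> d v w) | a v w.
          a \<in> carrier k \<and> v \<in> carrier V \<and> w \<in> carrier W} \<union>
       {d v (a \<odot>\<^bsub>W\<^esub> w) \<ominus>\<^bsub>F\<^esub> (a \<odot>\<^bsub>F\<^esub> d v w) | a v w.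
          a \<in> carrier k \<and> v \<in> carrier V \<and> w \<in> carrier W}))"

definition tensor_module ::
  "('k, 'm) ring_scheme \<Rightarrow> ('k, 'v, 'x) module_scheme \<Rightarrow> ('k, 'w, 'y) module_scheme
    \<Rightarrow> ('k, ('v \<times> 'w \<Rightarrow> 'k) set) module"
  where "tensor_module k V W =
    quotient_module (free_module k (carrier V \<times> carrier W)) (tensor_relations k V W)"

definition tensor ::
  "('k, 'm) ring_scheme \<Rightarrow> ('k, 'v, 'x) module_scheme \<Rightarrow> ('k, 'w, 'y) module_scheme
    \<Rightarrow> 'v \<Rightarrow> 'w \<Rightarrow> ('v \<times> 'w \<Rightarrow> 'k) set"
  where "tensor k V W v w =
    tensor_relations k V W +>\<^bsub>free_module k (carrier V \<times> carrier W)\<^esub> free_gen k (v, w)"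

text \<open>\<open>tensor_lift k U \<beta>\<close> is the linear map \<open>V \<otimes> W \<rightarrow> U\<close> with \<open>v \<otimes> w \<mapsto> \<beta> v w\<close> induced by a
  bilinear \<open>\<beta>\<close>. The value does not depend on the chosen representative when \<open>\<beta>\<close> is bilinear,
  and it is only used for such \<open>\<beta>\<close>.\<close>

definition tensor_lift ::
  "('k, 'm) ring_scheme \<Rightarrow> ('k, 'u, 'z) module_scheme \<Rightarrow> ('v \<Rightarrow> 'w \<Rightarrow> 'u)
    \<Rightarrow> ('v \<times> 'w \<Rightarrow> 'k) set \<Rightarrow> 'u"
  where "tensor_lift k U \<beta> t =
    (let u = (SOME u. u \<in> t)
     in \<Oplus>\<^bsub>U\<^esub>p\<in>{p. u p \<noteq> \<zero>\<^bsub>k\<^esub>}. u p \<odot>\<^bsub>U\<^esub> \<beta> (fst p) (snd p))"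

definition tensor_map ::
  "('k, 'm) ring_scheme \<Rightarrow> ('k, 'v', 'x) module_scheme \<Rightarrow> ('k, 'w', 'y) module_scheme
    \<Rightarrow> ('v \<Rightarrow> 'v') \<Rightarrow> ('w \<Rightarrow> 'w') \<Rightarrow> ('v \<times> 'w \<Rightarrow> 'k) set \<Rightarrow> ('v' \<times> 'w' \<Rightarrow> 'k) set"
  where "tensor_map k V' W' f g =
    tensor_lift k (tensor_module k V' W') (\<lambda>v w. tensor k V' W' (f v) (g w))"

text \<open>The canonical isomorphism \<open>(U \<otimes> V) \<otimes> W \<rightarrow> U \<otimes> (V \<otimes> W)\<close>.\<close>

definition tensor_assoc ::
  "('k, 'm) ring_scheme \<Rightarrow> ('k, 'u, 'x) module_scheme \<Rightarrow> ('k, 'v, 'y) module_scheme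
    \<Rightarrow> ('k, 'w, 'z) module_scheme
    \<Rightarrow> (('u \<times> 'v \<Rightarrow> 'k) set \<times> 'w \<Rightarrow> 'k) set \<Rightarrow> ('u \<times> ('v \<times> 'w \<Rightarrow> 'k) set \<Rightarrow> 'k) set"
  where "tensor_assoc k U V W =
    (let VW = tensor_module k V W; UVW = tensor_module k U VW in
     tensor_lift k UVW
       (\<lambda>t w. tensor_lift k UVW (\<lambda>u v. tensor k U VW u (tensor k V W v w)) t))"

text \<open>The tensor product of two algebras: \<open>(a \<otimes> b)(a' \<otimes> b') = aa' \<otimes> bb'\<close>.\<close>

definition tensor_algebra ::
  "('k, 'm) ring_scheme \<Rightarrow> ('k, 'a, 'x) module_scheme \<Rightarrow> ('k, 'b, 'y) module_scheme
    \<Rightarrow> ('k, ('a \<times> 'b \<Rightarrow> 'k) set) module"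
  where "tensor_algebra k A B =
    (let T = tensor_module k A B in
     T\<lparr>mult := (\<lambda>s t.
         tensor_lift k T (\<lambda>a b.
           tensor_lift k T (\<lambda>a' b'. tensor k A B (a \<otimes>\<^bsub>A\<^esub> a') (b \<otimes>\<^bsub>B\<^esub> b')) t) s),
       one := tensor k A B \<one>\<^bsub>A\<^esub> \<one>\<^bsub>B\<^esub>\<rparr>)"


section \<open>Algebras, coalgebras, bialgebras and Hopf algebras\<close>

text \<open>The library locale \<open>algebra\<close> demands commutativity, which is not assumed here.\<close>

locale unital_algebra = field k + module k A + ring A
  for k :: "('k, 'm) ring_scheme" (structure) and A :: "('k, 'a, 'x) module_scheme" (structure) +
  assumes smult_mult_left:
      "\<lbrakk>r \<in> carrier k; x \<in> carrier A; y \<in> carrier A\<rbrakk>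
        \<Longrightarrow> (r \<odot>\<^bsub>A\<^esub> x) \<otimes>\<^bsub>A\<^esub> y = r \<odot>\<^bsub>A\<^esub> (x \<otimes>\<^bsub>A\<^esub> y)"
    and smult_mult_right:
      "\<lbrakk>r \<in> carrier k; x \<in> carrier A; y \<in> carrier A\<rbrakk>
        \<Longrightarrow> x \<otimes>\<^bsub>A\<^esub> (r \<odot>\<^bsub>A\<^esub> y) = r \<odot>\<^bsub>A\<^esub> (x \<otimes>\<^bsub>A\<^esub> y)"

record ('k, 'c) coalgebra = "('k, 'c) module" +
  comult :: "'c \<Rightarrow> ('c \<times> 'c \<Rightarrow> 'k) set"
  counit :: "'c \<Rightarrow> 'k"

text \<open>\<open>sweedler k C U \<beta> c\<close> is the Sweedler sum of \<open>\<beta> c\<^sub>1 c\<^sub>2\<close>, a value in \<open>U\<close>.\<close>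

definition sweedler ::
  "('k, 'm) ring_scheme \<Rightarrow> ('k, 'c, 'x) coalgebra_scheme \<Rightarrow> ('k, 'u, 'y) module_scheme
    \<Rightarrow> ('c \<Rightarrow> 'c \<Rightarrow> 'u) \<Rightarrow> 'c \<Rightarrow> 'u"
  where "sweedler k C U \<beta> c = tensor_lift k U \<beta> (comult C c)"

locale coalgebra = field k + module k C
  for k :: "('k, 'm) ring_scheme" (structure) and C :: "('k, 'c, 'x) coalgebra_scheme" (structure) +
  assumes comult_linear: "comult C \<in> linear_maps k C (tensor_module k C C)"
    and counit_linear: "counit C \<in> linear_maps k C (scalar_module k)"
    and coassociative:
      "c \<in> carrier C \<Longrightarrow>
        tensor_assoc k C C C (tensor_map k (tensor_module k C C) C (comult C) id (comult C c))
          = tensor_map k C (tensor_module k C C) id (comult C) (comult C c)"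
    and counit_left:
      "c \<in> carrier C \<Longrightarrow> sweedler k C C (\<lambda>c\<^sub>1 c\<^sub>2. counit C c\<^sub>1 \<odot>\<^bsub>C\<^esub> c\<^sub>2) c = c"
    and counit_right:
      "c \<in> carrier C \<Longrightarrow> sweedler k C C (\<lambda>c\<^sub>1 c\<^sub>2. counit C c\<^sub>2 \<odot>\<^bsub>C\<^esub> c\<^sub>1) c = c"

locale bialgebra = unital_algebra k A + coalgebra k A
  for k :: "('k, 'm) ring_scheme" (structure) and A :: "('k, 'a, 'x) coalgebra_scheme" (structure) +
  assumes comult_hom: "comult A \<in> ring_hom A (tensor_algebra k A A)"
    and counit_hom: "counit A \<in> ring_hom A k"

definition antipode ::
  "('k, 'm) ring_scheme \<Rightarrow> ('k, 'a, 'x) coalgebra_scheme \<Rightarrow> ('a \<Rightarrow> 'a) \<Rightarrow> bool"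
  where "antipode k H S \<longleftrightarrow>
    S \<in> linear_maps k H H \<and>
    (\<forall>h\<in>carrier H.
       sweedler k H H (\<lambda>h\<^sub>1 h\<^sub>2. S h\<^sub>1 \<otimes>\<^bsub>H\<^esub> h\<^sub>2) h = counit H h \<odot>\<^bsub>H\<^esub> \<one>\<^bsub>H\<^esub> \<and>
       sweedler k H H (\<lambda>h\<^sub>1 h\<^sub>2. h\<^sub>1 \<otimes>\<^bsub>H\<^esub> S h\<^sub>2) h = counit H h \<odot>\<^bsub>H\<^esub> \<one>\<^bsub>H\<^esub>)"

locale hopf_algebra = bialgebra k H
  for k :: "('k, 'm) ring_scheme" (structure) and H :: "('k, 'a, 'x) coalgebra_scheme" (structure) +
  assumes has_antipode: "\<exists>S. antipode k H S"


section \<open>Measurings and coverings\<close>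

text \<open>\<open>\<Delta>(b \<otimes> c) = \<Sum> (b\<^sub>1 \<otimes> c\<^sub>1) \<otimes> (b\<^sub>2 \<otimes> c\<^sub>2)\<close> and \<open>\<epsilon>(b \<otimes> c) = \<epsilon>(b) \<epsilon>(c)\<close>.\<close>

definition tensor_coalgebra ::
  "('k, 'm) ring_scheme \<Rightarrow> ('k, 'b, 'x) coalgebra_scheme \<Rightarrow> ('k, 'c, 'y) coalgebra_scheme
    \<Rightarrow> ('k, ('b \<times> 'c \<Rightarrow> 'k) set) coalgebra"
  where "tensor_coalgebra k B C =
    (let T = tensor_module k B C; TT = tensor_module k T T in
     module.extend T
      (coalgebra.fields
        (tensor_lift k TT (\<lambda>b c.
         sweedler k B TT (\<lambda>b\<^sub>1 b\<^sub>2.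
           sweedler k C TT (\<lambda>c\<^sub>1 c\<^sub>2.
             tensor k T T (tensor k B C b\<^sub>1 c\<^sub>1) (tensor k B C b\<^sub>2 c\<^sub>2)) c) b))
        (tensor_lift k (scalar_module k) (\<lambda>b c. counit B b \<otimes>\<^bsub>k\<^esub> counit C c))))"

definition coalgebra_map ::
  "('k, 'm) ring_scheme \<Rightarrow> ('k, 'c, 'x) coalgebra_scheme \<Rightarrow> ('k, 'd, 'y) coalgebra_scheme
    \<Rightarrow> ('c \<Rightarrow> 'd) \<Rightarrow> bool"
  where "coalgebra_map k C D f \<longleftrightarrow>
    f \<in> linear_maps k C D \<and>
    (\<forall>c\<in>carrier C. comult D (f c) = tensor_map k D D f f (comult C c)) \<and>
    (\<forall>c\<in>carrier C. counit D (f c) = counit C c)"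

definition measuring ::
  "('k, 'm) ring_scheme \<Rightarrow> ('k, 'b, 'x) coalgebra_scheme \<Rightarrow> ('k, 'c, 'y) coalgebra_scheme
    \<Rightarrow> ('k, 'a, 'z) coalgebra_scheme \<Rightarrow> (('b \<times> 'c \<Rightarrow> 'k) set \<Rightarrow> 'a) \<Rightarrow> bool"
  where "measuring k B C A f \<longleftrightarrow>
    f \<in> linear_maps k (tensor_module k B C) A \<and>
    (\<forall>b\<in>carrier B. \<forall>b'\<in>carrier B. \<forall>c\<in>carrier C.
       f (tensor k B C (b \<otimes>\<^bsub>B\<^esub> b') c) =
         sweedler k C A (\<lambda>c\<^sub>1 c\<^sub>2. f (tensor k B C b c\<^sub>1) \<otimes>\<^bsub>A\<^esub> f (tensor k B C b' c\<^sub>2)) c) \<and>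
    (\<forall>c\<in>carrier C. f (tensor k B C \<one>\<^bsub>B\<^esub> c) = counit C c \<odot>\<^bsub>A\<^esub> \<one>\<^bsub>A\<^esub>)"

definition partial_covering ::
  "('k, 'm) ring_scheme \<Rightarrow> ('k, 'b, 'x) coalgebra_scheme \<Rightarrow> ('k, 'c, 'y) coalgebra_scheme
    \<Rightarrow> ('k, 'a, 'z) coalgebra_scheme \<Rightarrow> (('b \<times> 'c \<Rightarrow> 'k) set \<Rightarrow> 'a) \<Rightarrow> bool"
  where "partial_covering k B C A f \<longleftrightarrow>
    measuring k B C A f \<and> coalgebra_map k (tensor_coalgebra k B C) A f"

definition covering ::
  "('k, 'm) ring_scheme \<Rightarrow> ('k, 'b, 'x) coalgebra_scheme \<Rightarrow> ('k, 'c, 'y) coalgebra_scheme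
    \<Rightarrow> ('k, 'a, 'z) coalgebra_scheme \<Rightarrow> (('b \<times> 'c \<Rightarrow> 'k) set \<Rightarrow> 'a) \<Rightarrow> bool"
  where "covering k B C A f \<longleftrightarrow>
    partial_covering k B C A f \<and> f ` carrier (tensor_module k B C) = carrier A"

end

theory Submission
  imports Defs
begin

text \<open>An antipode of \<open>A\<close> is an inverse of the identity map in the convolution algebra \<open>Hom(A, A)\<close>,
  whose product is \<open>(g * h)(a) = g(a\<^sub>1) h(a\<^sub>2)\<close>. So the task is to invert \<open>id\<close> there. The covering
  \<open>f : B \<otimes> C \<rightarrow> A\<close> does this in a larger algebra.

  The measuring conditions say that \<open>b \<mapsto> f(b \<otimes> -)\<close> is an algebra map from \<open>B\<close> to the convolution
  algebra \<open>Hom(C, A)\<close>. An algebra map \<open>F\<close> from a Hopf algebra has the convolution inverse \<open>F \<circ> S\<close>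
  (\<open>hopf_algebra_map_unit\<close>), so the curried \<open>f\<close> is invertible in \<open>Hom(B, Hom(C, A))\<close>. As \<open>f\<close> is a
  coalgebra map, \<open>h \<mapsto> h \<circ> f\<close> is multiplicative from \<open>Hom(A, A)\<close> to that algebra (\<open>pullback_mult\<close>), and
  it is injective as \<open>f\<close> is surjective (\<open>pullback_zero_iff\<close>). It sends \<open>id\<close> to the invertible
  element \<open>f\<close>, so \<open>id * h = 0\<close> implies \<open>h = 0\<close>.

  The inverse of \<open>f\<close> need not come from \<open>Hom(A, A)\<close> by itself. Here the finite dimension of \<open>A\<close> enters:
  the powers of \<open>id\<close> are linearly dependent (\<open>linear_maps_dependent\<close>), and a left regular element
  satisfying a polynomial equation is invertible, with an inverse that is a polynomial in it
  (\<open>regular_algebraic_unit\<close>).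

  All Sweedler calculus rests on the universal property of the tensor product
  (\<open>tensor_lift_tensor\<close>, \<open>tensor_lift_linear\<close>, \<open>linear_maps_eq_on_tensors\<close>) and on the Sweedler form of
  coassociativity (\<open>sweedler_coassociative\<close>).\<close>

section \<open>Linear maps, spans and quotients\<close>

definition bilinear_maps ::
  "('k, 'm) ring_scheme \<Rightarrow> ('k, 'v, 'x) module_scheme \<Rightarrow> ('k, 'w, 'y) module_scheme
    \<Rightarrow> ('k, 'u, 'z) module_scheme \<Rightarrow> ('v \<Rightarrow> 'w \<Rightarrow> 'u) set"
  where "bilinear_maps k V W U =
    {\<beta>. (\<forall>v\<in>carrier V. \<beta> v \<in> linear_maps k W U) \<and>
        (\<forall>w\<in>carrier W. (\<lambda>v. \<beta> v w) \<in> linear_maps k V U)}"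

lemma linear_mapsI:
  assumes "\<And>x. x \<in> carrier V \<Longrightarrow> h x \<in> carrier W"
    and "\<And>x y. \<lbrakk>x \<in> carrier V; y \<in> carrier V\<rbrakk> \<Longrightarrow> h (x \<oplus>\<^bsub>V\<^esub> y) = h x \<oplus>\<^bsub>W\<^esub> h y"
    and "\<And>a x. \<lbrakk>a \<in> carrier k; x \<in> carrier V\<rbrakk> \<Longrightarrow> h (a \<odot>\<^bsub>V\<^esub> x) = a \<odot>\<^bsub>W\<^esub> h x"
  shows "h \<in> linear_maps k V W"
  using assms unfolding linear_maps_def by auto

lemma linear_mapsD:
  assumes "h \<in> linear_maps k V W"
  shows "x \<in> carrier V \<Longrightarrow> h x \<in> carrier W"
    and "\<lbrakk>x \<in> carrier V; y \<in> carrier V\<rbrakk> \<Longrightarrow> h (x \<oplus>\<^bsub>V\<^esub> y) = h x \<oplus>\<^bsub>W\<^esub> h y"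
    and "\<lbrakk>a \<in> carrier k; x \<in> carrier V\<rbrakk> \<Longrightarrow> h (a \<odot>\<^bsub>V\<^esub> x) = a \<odot>\<^bsub>W\<^esub> h x"
  using assms unfolding linear_maps_def by auto

lemma linear_maps_compose:
  assumes "g \<in> linear_maps k V W" "h \<in> linear_maps k W U"
  shows "(\<lambda>x. h (g x)) \<in> linear_maps k V U"
  using assms unfolding linear_maps_def by (auto simp: Pi_iff)

lemma linear_maps_cong:
  assumes "module k V" "\<And>x. x \<in> carrier V \<Longrightarrow> g x = h x"
  shows "g \<in> linear_maps k V W \<longleftrightarrow> h \<in> linear_maps k V W"
proof -
  interpret V: module k V by fact
  show ?thesis
    using assms(2) unfolding linear_maps_def by (auto simp: Pi_iff)
qed

lemma linear_maps_id: "(\<lambda>x. x) \<in> linear_maps k V V"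
  by (rule linear_mapsI) simp_all

lemma linear_maps_zero:
  assumes "module k V" "module k W" "h \<in> linear_maps k V W"
  shows "h \<zero>\<^bsub>V\<^esub> = \<zero>\<^bsub>W\<^esub>"
proof -
  interpret V: module k V by fact
  interpret W: module k W by fact
  have "h \<zero>\<^bsub>V\<^esub> = h (\<zero>\<^bsub>k\<^esub> \<odot>\<^bsub>V\<^esub> \<zero>\<^bsub>V\<^esub>)" by simp
  also have "\<dots> = \<zero>\<^bsub>k\<^esub> \<odot>\<^bsub>W\<^esub> h \<zero>\<^bsub>V\<^esub>"
    using linear_mapsD(3)[OF assms(3)] by blast
  also have "\<dots> = \<zero>\<^bsub>W\<^esub>" using linear_mapsD(1)[OF assms(3)] by simp
  finally show ?thesis .
qed

lemma linear_maps_minus: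
  assumes "module k V" "module k W" "h \<in> linear_maps k V W" "x \<in> carrier V"
  shows "h (\<ominus>\<^bsub>V\<^esub> x) = \<ominus>\<^bsub>W\<^esub> h x"
proof -
  interpret V: module k V by fact
  interpret W: module k W by fact
  have "h (\<ominus>\<^bsub>V\<^esub> x) \<oplus>\<^bsub>W\<^esub> h x = h (\<ominus>\<^bsub>V\<^esub> x \<oplus>\<^bsub>V\<^esub> x)"
    using linear_mapsD(2)[OF assms(3)] assms(4) by simp
  also have "\<dots> = \<zero>\<^bsub>W\<^esub>"
    using assms linear_maps_zero[OF assms(1,2,3)] by (simp add: V.M.l_neg)
  finally show ?thesis
    using linear_mapsD(1)[OF assms(3)] assms(4) W.M.minus_equality by auto
qed

lemma linear_maps_finsum:
  assumes "module k V" "module k W" "h \<in> linear_maps k V W"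
    and "finite I" "f \<in> I \<rightarrow> carrier V"
  shows "h (\<Oplus>\<^bsub>V\<^esub>i\<in>I. f i) = (\<Oplus>\<^bsub>W\<^esub>i\<in>I. h (f i))"
proof -
  interpret V: module k V by fact
  interpret W: module k W by fact
  show ?thesis
    using assms(4,5)
  proof (induction I)
    case empty
    then show ?case using linear_maps_zero[OF assms(1,2,3)] by simp
  next
    case (insert i I)
    have "(\<lambda>i. h (f i)) \<in> insert i I \<rightarrow> carrier W"
      using insert.prems linear_mapsD(1)[OF assms(3)] by auto
    then show ?case
      using insert linear_mapsD(2)[OF assms(3)] by (simp add: Pi_iff)
  qed
qed

lemma linear_maps_add:
  assumes "module k W" "g \<in> linear_maps k V W" "h \<in> linear_maps k V W"
  shows "(\<lambda>x. g x \<oplus>\<^bsub>W\<^esub> h x) \<in> linear_maps k V W"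
proof -
  interpret W: module k W by fact
  show ?thesis
    using linear_mapsD[OF assms(2)] linear_mapsD[OF assms(3)]
    by (intro linear_mapsI) (simp_all add: W.smult_r_distr W.M.a_ac)
qed

lemma linear_maps_smult:
  assumes "module k W" "g \<in> linear_maps k V W" "a \<in> carrier k"
  shows "(\<lambda>x. a \<odot>\<^bsub>W\<^esub> g x) \<in> linear_maps k V W"
proof -
  interpret W: module k W by fact
  show ?thesis
    using linear_mapsD[OF assms(2)] assms(3)
    by (intro linear_mapsI)
      (simp_all add: W.smult_r_distr W.R.m_comm flip: W.smult_assoc1)
qed

lemma linear_maps_const_zero:
  assumes "module k W"
  shows "(\<lambda>x. \<zero>\<^bsub>W\<^esub>) \<in> linear_maps k V W"
proof -
  interpret W: module k W by fact
  show ?thesis by (rule linear_mapsI) simp_all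
qed

lemma bilinear_mapsI:
  assumes "\<And>v. v \<in> carrier V \<Longrightarrow> \<beta> v \<in> linear_maps k W U"
    and "\<And>w. w \<in> carrier W \<Longrightarrow> (\<lambda>v. \<beta> v w) \<in> linear_maps k V U"
  shows "\<beta> \<in> bilinear_maps k V W U"
  using assms unfolding bilinear_maps_def by auto

lemma bilinear_mapsD:
  assumes "\<beta> \<in> bilinear_maps k V W U"
  shows "v \<in> carrier V \<Longrightarrow> \<beta> v \<in> linear_maps k W U"
    and "w \<in> carrier W \<Longrightarrow> (\<lambda>v. \<beta> v w) \<in> linear_maps k V U"
    and "\<lbrakk>v \<in> carrier V; w \<in> carrier W\<rbrakk> \<Longrightarrow> \<beta> v w \<in> carrier U"
  using assms linear_mapsD(1) unfolding bilinear_maps_def by fastforce+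

lemma bilinear_maps_compose:
  assumes "\<beta> \<in> bilinear_maps k V W U"
    and "g \<in> linear_maps k V' V" "h \<in> linear_maps k W' W" "l \<in> linear_maps k U U'"
  shows "(\<lambda>x y. l (\<beta> (g x) (h y))) \<in> bilinear_maps k V' W' U'"
proof (rule bilinear_mapsI)
  fix v assume "v \<in> carrier V'"
  then have "\<beta> (g v) \<in> linear_maps k W U"
    using bilinear_mapsD(1)[OF assms(1)] linear_mapsD(1)[OF assms(2)] by blast
  from linear_maps_compose[OF linear_maps_compose[OF assms(3) this] assms(4)]
  show "(\<lambda>y. l (\<beta> (g v) (h y))) \<in> linear_maps k W' U'" .
next
  fix w assume "w \<in> carrier W'"
  then have "(\<lambda>x. \<beta> x (h w)) \<in> linear_maps k V U"
    using bilinear_mapsD(2)[OF assms(1)] linear_mapsD(1)[OF assms(3)] by blast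
  from linear_maps_compose[OF linear_maps_compose[OF assms(2) this] assms(4)]
  show "(\<lambda>x. l (\<beta> (g x) (h w))) \<in> linear_maps k V' U'" .
qed

lemma linear_maps_kernel_submodule:
  assumes "module k V" "module k W" "h \<in> linear_maps k V W"
  shows "submodule {x \<in> carrier V. h x = \<zero>\<^bsub>W\<^esub>} k V"
proof -
  interpret V: module k V by fact
  interpret W: module k W by fact
  show ?thesis
    using linear_mapsD[OF assms(3)] linear_maps_zero[OF assms] linear_maps_minus[OF assms]
    by (intro V.submoduleI) auto
qed

lemma linear_span_submodule:
  assumes "module k V" "S \<subseteq> carrier V"
  shows "submodule (linear_span k V S) k V"
proof -
  interpret V: module k V by fact
  note E = V.submoduleE
  have z: "\<zero>\<^bsub>V\<^esub> \<in> H" if "submodule H k V" for H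
    using subgroup.one_closed[OF submodule.axioms(1)[OF that]] by simp
  show ?thesis
    unfolding linear_span_def
  proof (rule V.submoduleI)
    show "\<Inter> {H. submodule H k V \<and> S \<subseteq> H} \<subseteq> carrier V"
      using V.carrier_is_submodule assms(2) by blast
  qed (use z E in auto)
qed

lemma linear_span_minimal:
  assumes "submodule H k V" "S \<subseteq> H"
  shows "linear_span k V S \<subseteq> H"
  using assms unfolding linear_span_def by blast

lemma linear_span_incl: "S \<subseteq> linear_span k V S"
  unfolding linear_span_def by blast

lemma submodule_abelian_subgroup:
  assumes "module k V" "submodule N k V"
  shows "abelian_subgroup N V"
proof -
  interpret V: module k V by fact
  show ?thesis
    by (intro abelian_subgroupI3 additive_subgroup.intro submodule.axioms(1)[OF assms(2)]
        V.abelian_group_axioms)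
qed

text \<open>Scalar multiplication of a coset is a union over all representatives. These all give the same
  coset, because \<open>N\<close> is closed under scalars.\<close>

lemma quotient_module_smult:
  assumes "module k V" "submodule N k V" "a \<in> carrier k" "v \<in> carrier V"
  shows "a \<odot>\<^bsub>quotient_module V N\<^esub> (N +>\<^bsub>V\<^esub> v) = N +>\<^bsub>V\<^esub> (a \<odot>\<^bsub>V\<^esub> v)"
proof -
  interpret V: module k V by fact
  interpret N: abelian_subgroup N V
    by (rule submodule_abelian_subgroup[OF assms(1,2)])
  have *: "N +>\<^bsub>V\<^esub> (a \<odot>\<^bsub>V\<^esub> x) = N +>\<^bsub>V\<^esub> (a \<odot>\<^bsub>V\<^esub> v)" if x: "x \<in> N +>\<^bsub>V\<^esub> v" for x
  proof -
    have xc: "x \<in> carrier V" using N.a_elemrcos_carrier[OF assms(4) x] .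
    have "x \<oplus>\<^bsub>V\<^esub> \<ominus>\<^bsub>V\<^esub> v \<in> N" using N.a_rcos_module_imp[OF assms(4) x] .
    then have "a \<odot>\<^bsub>V\<^esub> (x \<oplus>\<^bsub>V\<^esub> \<ominus>\<^bsub>V\<^esub> v) \<in> N"
      using submodule.smult_closed[OF assms(2)] assms(3) by blast
    then have "a \<odot>\<^bsub>V\<^esub> x \<oplus>\<^bsub>V\<^esub> \<ominus>\<^bsub>V\<^esub> (a \<odot>\<^bsub>V\<^esub> v) \<in> N"
      using xc assms by (simp add: V.smult_r_distr V.smult_r_minus)
    then have "a \<odot>\<^bsub>V\<^esub> x \<in> N +>\<^bsub>V\<^esub> (a \<odot>\<^bsub>V\<^esub> v)"
      using xc assms by (intro N.a_rcos_module_rev) auto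
    then show ?thesis using N.a_repr_independence' assms by auto
  qed
  have "(\<Union>x\<in>N +>\<^bsub>V\<^esub> v. N +>\<^bsub>V\<^esub> (a \<odot>\<^bsub>V\<^esub> x)) = (\<Union>x\<in>N +>\<^bsub>V\<^esub> v. N +>\<^bsub>V\<^esub> (a \<odot>\<^bsub>V\<^esub> v))"
    by (rule SUP_cong[OF refl *])
  also have "\<dots> = N +>\<^bsub>V\<^esub> (a \<odot>\<^bsub>V\<^esub> v)"
    using N.a_rcos_self[OF assms(4)] by blast
  finally show ?thesis
    unfolding quotient_module_def by simp
qed

lemma quotient_module_carrier:
  "carrier (quotient_module V N) = (\<lambda>v. N +>\<^bsub>V\<^esub> v) ` carrier V"
  unfolding quotient_module_def A_RCOSETS_def' by auto

lemma quotient_module_add: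
  assumes "module k V" "submodule N k V" "v \<in> carrier V" "w \<in> carrier V"
  shows "(N +>\<^bsub>V\<^esub> v) \<oplus>\<^bsub>quotient_module V N\<^esub> (N +>\<^bsub>V\<^esub> w) = N +>\<^bsub>V\<^esub> (v \<oplus>\<^bsub>V\<^esub> w)"
proof -
  interpret N: abelian_subgroup N V
    by (rule submodule_abelian_subgroup[OF assms(1,2)])
  show ?thesis
    using N.a_rcos_sum assms(3,4) unfolding quotient_module_def by simp
qed

lemma quotient_module_zero:
  assumes "module k V" "submodule N k V"
  shows "\<zero>\<^bsub>quotient_module V N\<^esub> = N +>\<^bsub>V\<^esub> \<zero>\<^bsub>V\<^esub>"
proof -
  interpret N: abelian_subgroup N V
    by (rule submodule_abelian_subgroup[OF assms])
  show ?thesis using N.a_rcos_const[of "\<zero>\<^bsub>V\<^esub>"] unfolding quotient_module_def by simp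
qed

lemma quotient_module_is_module:
  assumes "module k V" "submodule N k V"
  shows "module k (quotient_module V N)"
proof -
  interpret V: module k V by fact
  note s [simp] = quotient_module_smult[OF assms] quotient_module_add[OF assms]
    quotient_module_zero[OF assms]
  show ?thesis
  proof (rule moduleI)
    show "abelian_group (quotient_module V N)"
    proof (rule abelian_groupI)
      fix x assume "x \<in> carrier (quotient_module V N)"
      then obtain v where v: "v \<in> carrier V" "x = N +>\<^bsub>V\<^esub> v"
        by (auto simp: quotient_module_carrier)
      then show "\<exists>y\<in>carrier (quotient_module V N).
          y \<oplus>\<^bsub>quotient_module V N\<^esub> x = \<zero>\<^bsub>quotient_module V N\<^esub>"
        by (intro bexI[of _ "N +>\<^bsub>V\<^esub> (\<ominus>\<^bsub>V\<^esub> v)"])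
          (auto simp: quotient_module_carrier V.M.l_neg)
    qed (auto simp: quotient_module_carrier V.M.a_ac)
  qed (auto simp: quotient_module_carrier V.smult_r_distr V.smult_l_distr V.smult_assoc1
      V.R.cring_axioms)
qed

lemma quotient_module_eq:
  assumes "module k V" "submodule N k V" "v \<in> carrier V" "w \<in> carrier V"
    and "v \<ominus>\<^bsub>V\<^esub> w \<in> N"
  shows "N +>\<^bsub>V\<^esub> v = N +>\<^bsub>V\<^esub> w"
proof -
  interpret N: abelian_subgroup N V
    by (rule submodule_abelian_subgroup[OF assms(1,2)])
  have "v \<in> N +>\<^bsub>V\<^esub> w"
    using N.a_rcos_module_rev[of w v] assms unfolding a_minus_def by auto
  then show ?thesis using N.a_repr_independence' assms(4) by metis
qed

section \<open>Free modules and tensor products\<close>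

definition free_lift ::
  "('k, 'm) ring_scheme \<Rightarrow> ('k, 'u, 'z) module_scheme \<Rightarrow> ('i \<Rightarrow> 'u) \<Rightarrow> ('i \<Rightarrow> 'k) \<Rightarrow> 'u"
  where "free_lift k U g u = (\<Oplus>\<^bsub>U\<^esub>i\<in>{i. u i \<noteq> \<zero>\<^bsub>k\<^esub>}. u i \<odot>\<^bsub>U\<^esub> g i)"

lemma free_module_is_module:
  fixes k :: "('k, 'm) ring_scheme" and I :: "'i set"
  assumes "cring k"
  shows "module k (free_module k I)"
proof -
  interpret k: cring k by fact
  let ?F = "free_module k I"
  have fin: "finite {i. u i \<oplus>\<^bsub>k\<^esub> v i \<noteq> \<zero>\<^bsub>k\<^esub>}"
    if "finite {i. u i \<noteq> \<zero>\<^bsub>k\<^esub>}" "finite {i. v i \<noteq> \<zero>\<^bsub>k\<^esub>}" for u v :: "'i \<Rightarrow> 'k"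
    by (rule finite_subset[of _ "{i. u i \<noteq> \<zero>\<^bsub>k\<^esub>} \<union> {i. v i \<noteq> \<zero>\<^bsub>k\<^esub>}"]) (use that in auto)
  have fin': "finite {i. a \<otimes>\<^bsub>k\<^esub> u i \<noteq> \<zero>\<^bsub>k\<^esub>}"
    if "finite {i. u i \<noteq> \<zero>\<^bsub>k\<^esub>}" "a \<in> carrier k" for u :: "'i \<Rightarrow> 'k" and a
    by (rule finite_subset[of _ "{i. u i \<noteq> \<zero>\<^bsub>k\<^esub>}"]) (use that in auto)
  have car: "u i \<in> carrier k" if "u \<in> carrier ?F" for u i
    using that unfolding free_module_def by (cases "i \<in> I") auto
  have closed: "u \<oplus>\<^bsub>?F\<^esub> v \<in> carrier ?F" if "u \<in> carrier ?F" "v \<in> carrier ?F" for u v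
    using that by (simp add: free_module_def fin)
  have closed': "a \<odot>\<^bsub>?F\<^esub> u \<in> carrier ?F" if "a \<in> carrier k" "u \<in> carrier ?F" for a u
    using that by (simp add: free_module_def fin')
  have ops [simp]: "u \<oplus>\<^bsub>?F\<^esub> v = (\<lambda>i. u i \<oplus>\<^bsub>k\<^esub> v i)" "\<zero>\<^bsub>?F\<^esub> = (\<lambda>i. \<zero>\<^bsub>k\<^esub>)"
    "a \<odot>\<^bsub>?F\<^esub> u = (\<lambda>i. a \<otimes>\<^bsub>k\<^esub> u i)" for u v a
    by (simp_all add: free_module_def)
  show ?thesis
  proof (rule moduleI)
    show "abelian_group ?F"
    proof (rule abelian_groupI)
      fix u assume u: "u \<in> carrier ?F"
      have "{i. \<ominus>\<^bsub>k\<^esub> u i \<noteq> \<zero>\<^bsub>k\<^esub>} \<subseteq> {i. u i \<noteq> \<zero>\<^bsub>k\<^esub>}" by auto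
      then have "(\<lambda>i. \<ominus>\<^bsub>k\<^esub> u i) \<in> carrier ?F"
        using u unfolding free_module_def by (auto intro: finite_subset)
      then show "\<exists>y\<in>carrier ?F. y \<oplus>\<^bsub>?F\<^esub> u = \<zero>\<^bsub>?F\<^esub>"
        using car[OF u] by (intro bexI[of _ "\<lambda>i. \<ominus>\<^bsub>k\<^esub> u i"]) (simp_all add: k.l_neg)
      show "\<zero>\<^bsub>?F\<^esub> \<oplus>\<^bsub>?F\<^esub> u = u" using car[OF u] by simp
      fix v assume v: "v \<in> carrier ?F"
      show "u \<oplus>\<^bsub>?F\<^esub> v \<in> carrier ?F" by (rule closed[OF u v])
      show "u \<oplus>\<^bsub>?F\<^esub> v = v \<oplus>\<^bsub>?F\<^esub> u" using car[OF u] car[OF v] by (simp add: k.a_comm)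
      fix w assume w: "w \<in> carrier ?F"
      show "u \<oplus>\<^bsub>?F\<^esub> v \<oplus>\<^bsub>?F\<^esub> w = u \<oplus>\<^bsub>?F\<^esub> (v \<oplus>\<^bsub>?F\<^esub> w)"
        using car[OF u] car[OF v] car[OF w] by (simp add: k.a_assoc)
    qed (simp add: free_module_def)
    fix a u assume a: "a \<in> carrier k" and u: "u \<in> carrier ?F"
    show "a \<odot>\<^bsub>?F\<^esub> u \<in> carrier ?F" by (rule closed'[OF a u])
    fix v assume v: "v \<in> carrier ?F"
    show "a \<odot>\<^bsub>?F\<^esub> (u \<oplus>\<^bsub>?F\<^esub> v) = a \<odot>\<^bsub>?F\<^esub> u \<oplus>\<^bsub>?F\<^esub> a \<odot>\<^bsub>?F\<^esub> v"
      using a car[OF u] car[OF v] by (simp add: k.r_distr)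
  next
    fix a b u assume a: "a \<in> carrier k" and b: "b \<in> carrier k" and u: "u \<in> carrier ?F"
    show "(a \<oplus>\<^bsub>k\<^esub> b) \<odot>\<^bsub>?F\<^esub> u = a \<odot>\<^bsub>?F\<^esub> u \<oplus>\<^bsub>?F\<^esub> b \<odot>\<^bsub>?F\<^esub> u"
      and "(a \<otimes>\<^bsub>k\<^esub> b) \<odot>\<^bsub>?F\<^esub> u = a \<odot>\<^bsub>?F\<^esub> (b \<odot>\<^bsub>?F\<^esub> u)"
      using a b car[OF u] by (simp_all add: k.l_distr k.m_assoc)
  next
    fix u assume u: "u \<in> carrier ?F"
    show "\<one>\<^bsub>k\<^esub> \<odot>\<^bsub>?F\<^esub> u = u" using car[OF u] by simp
  qed (rule assms)
qed

lemma free_gen_closed: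
  assumes "cring k" "i \<in> I"
  shows "free_gen k i \<in> carrier (free_module k I)"
proof -
  interpret k: cring k by fact
  have "finite {j. free_gen k i j \<noteq> \<zero>\<^bsub>k\<^esub>}"
    by (rule finite_subset[of _ "{i}"]) (auto simp: free_gen_def)
  then show ?thesis
    using assms(2) unfolding free_module_def free_gen_def by auto
qed

lemma free_module_support:
  assumes "u \<in> carrier (free_module k I)"
  shows "finite {i. u i \<noteq> \<zero>\<^bsub>k\<^esub>}" "{i. u i \<noteq> \<zero>\<^bsub>k\<^esub>} \<subseteq> I"
    "i \<in> I \<Longrightarrow> u i \<in> carrier k"
  using assms unfolding free_module_def by auto

text \<open>The sum may be taken over any finite set containing the support. This puts the sums for \<open>u\<close>,
  \<open>v\<close> and \<open>u + v\<close> on a common index set.\<close>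

lemma free_lift_superset:
  assumes "module k U" "g \<in> I \<rightarrow> carrier U" "u \<in> carrier (free_module k I)"
    and "finite S" "{i. u i \<noteq> \<zero>\<^bsub>k\<^esub>} \<subseteq> S" "S \<subseteq> I"
  shows "free_lift k U g u = (\<Oplus>\<^bsub>U\<^esub>i\<in>S. u i \<odot>\<^bsub>U\<^esub> g i)"
proof -
  interpret U: module k U by fact
  note s = free_module_support[OF assms(3)]
  show ?thesis
    unfolding free_lift_def
    by (rule U.M.add.finprod_mono_neutral_cong_left)
      (use assms s in \<open>auto simp: Pi_iff subset_iff\<close>)
qed

lemma free_lift_linear:
  assumes "module k U" "g \<in> I \<rightarrow> carrier U"
  shows "free_lift k U g \<in> linear_maps k (free_module k I) U"
proof -
  interpret U: module k U by fact
  let ?F = "free_module k I"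
  interpret F: module k ?F
    by (rule free_module_is_module[OF U.R.cring_axioms])
  have summand: "u i \<odot>\<^bsub>U\<^esub> g i \<in> carrier U" if "u \<in> carrier ?F" "i \<in> I" for u i
    using free_module_support[OF that(1)] assms(2) that by auto
  show ?thesis
  proof (rule linear_mapsI)
    fix u assume u: "u \<in> carrier ?F"
    note s = free_module_support[OF u]
    show "free_lift k U g u \<in> carrier U"
      unfolding free_lift_def using summand[OF u] s by (intro U.M.finsum_closed) auto
    fix a assume a: "a \<in> carrier k"
    have sub: "{i. (a \<odot>\<^bsub>?F\<^esub> u) i \<noteq> \<zero>\<^bsub>k\<^esub>} \<subseteq> {i. u i \<noteq> \<zero>\<^bsub>k\<^esub>}"
      using a by (auto simp: free_module_def)
    have "free_lift k U g (a \<odot>\<^bsub>?F\<^esub> u) = (\<Oplus>\<^bsub>U\<^esub>i\<in>{i. u i \<noteq> \<zero>\<^bsub>k\<^esub>}. (a \<odot>\<^bsub>?F\<^esub> u) i \<odot>\<^bsub>U\<^esub> g i)"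
      using free_lift_superset[OF assms F.smult_closed[OF a u] s(1) sub s(2)] .
    also have "\<dots> = (\<Oplus>\<^bsub>U\<^esub>i\<in>{i. u i \<noteq> \<zero>\<^bsub>k\<^esub>}. a \<odot>\<^bsub>U\<^esub> (u i \<odot>\<^bsub>U\<^esub> g i))"
      by (rule U.M.finsum_cong')
        (use s a assms(2) in \<open>auto simp: free_module_def U.smult_assoc1 Pi_iff subset_iff\<close>)
    also have "\<dots> = a \<odot>\<^bsub>U\<^esub> free_lift k U g u"
      unfolding free_lift_def
      by (rule U.finsum_smult_ldistr[symmetric]) (use s a summand[OF u] in auto)
    finally show "free_lift k U g (a \<odot>\<^bsub>?F\<^esub> u) = a \<odot>\<^bsub>U\<^esub> free_lift k U g u" .
  next
    fix u v assume u: "u \<in> carrier ?F" and v: "v \<in> carrier ?F"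
    note su = free_module_support[OF u]
    note sv = free_module_support[OF v]
    let ?S = "{i. u i \<noteq> \<zero>\<^bsub>k\<^esub>} \<union> {i. v i \<noteq> \<zero>\<^bsub>k\<^esub>}"
    have S: "finite ?S" "?S \<subseteq> I" using su sv by auto
    have uv: "(u \<oplus>\<^bsub>?F\<^esub> v) i = u i \<oplus>\<^bsub>k\<^esub> v i" for i
      by (simp add: free_module_def)
    have sub: "{i. (u \<oplus>\<^bsub>?F\<^esub> v) i \<noteq> \<zero>\<^bsub>k\<^esub>} \<subseteq> ?S"
      by (auto simp: uv)
    have "free_lift k U g (u \<oplus>\<^bsub>?F\<^esub> v) = (\<Oplus>\<^bsub>U\<^esub>i\<in>?S. (u \<oplus>\<^bsub>?F\<^esub> v) i \<odot>\<^bsub>U\<^esub> g i)"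
      using free_lift_superset[OF assms F.M.a_closed[OF u v] S(1) sub S(2)] .
    also have "\<dots> = (\<Oplus>\<^bsub>U\<^esub>i\<in>?S. u i \<odot>\<^bsub>U\<^esub> g i \<oplus>\<^bsub>U\<^esub> v i \<odot>\<^bsub>U\<^esub> g i)"
    proof (rule U.M.finsum_cong'[OF refl])
      show "(\<lambda>i. u i \<odot>\<^bsub>U\<^esub> g i \<oplus>\<^bsub>U\<^esub> v i \<odot>\<^bsub>U\<^esub> g i) \<in> ?S \<rightarrow> carrier U"
        using S(2) summand[OF u] summand[OF v] by blast
      fix i assume "i \<in> ?S"
      then have "i \<in> I" using S(2) by blast
      then show "(u \<oplus>\<^bsub>?F\<^esub> v) i \<odot>\<^bsub>U\<^esub> g i = u i \<odot>\<^bsub>U\<^esub> g i \<oplus>\<^bsub>U\<^esub> v i \<odot>\<^bsub>U\<^esub> g i"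
        using U.smult_l_distr[of "u i" "v i" "g i"] su(3) sv(3) assms(2) unfolding uv by blast
    qed
    also have "\<dots> = (\<Oplus>\<^bsub>U\<^esub>i\<in>?S. u i \<odot>\<^bsub>U\<^esub> g i) \<oplus>\<^bsub>U\<^esub> (\<Oplus>\<^bsub>U\<^esub>i\<in>?S. v i \<odot>\<^bsub>U\<^esub> g i)"
      by (rule U.M.finsum_addf) (use S(2) summand[OF u] summand[OF v] in blast)+
    also have "\<dots> = free_lift k U g u \<oplus>\<^bsub>U\<^esub> free_lift k U g v"
      using free_lift_superset[OF assms u S(1) _ S(2)] free_lift_superset[OF assms v S(1) _ S(2)]
      by auto
    finally show "free_lift k U g (u \<oplus>\<^bsub>?F\<^esub> v) = free_lift k U g u \<oplus>\<^bsub>U\<^esub> free_lift k U g v" .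
  qed
qed

lemma free_lift_free_gen:
  assumes "module k U" "g \<in> I \<rightarrow> carrier U" "i \<in> I"
  shows "free_lift k U g (free_gen k i) = g i"
proof -
  interpret U: module k U by fact
  have "free_lift k U g (free_gen k i) = (\<Oplus>\<^bsub>U\<^esub>j\<in>{i}. free_gen k i j \<odot>\<^bsub>U\<^esub> g j)"
    by (rule free_lift_superset[OF assms(1,2) free_gen_closed[OF U.R.cring_axioms assms(3)]])
      (use assms(3) in \<open>auto simp: free_gen_def\<close>)
  also have "\<dots> = g i"
  proof -
    have "g i \<in> carrier U" using assms(2,3) by auto
    then show ?thesis by (simp add: free_gen_def)
  qed
  finally show ?thesis .
qed

text \<open>Induction on a finite set containing the support, splitting off one generator at a time.\<close>

lemma free_module_subset_submodule:
  assumes "cring k" "submodule H k (free_module k I)" "\<And>i. i \<in> I \<Longrightarrow> free_gen k i \<in> H"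
  shows "carrier (free_module k I) \<subseteq> H"
proof -
  interpret k: cring k by fact
  let ?F = "free_module k I"
  interpret F: module k ?F by (rule free_module_is_module[OF assms(1)])
  note E = F.submoduleE[OF assms(2)]
  have zero: "\<zero>\<^bsub>?F\<^esub> \<in> H"
    using subgroup.one_closed[OF submodule.axioms(1)[OF assms(2)]] by simp
  have "u \<in> H" if "finite S" "u \<in> carrier ?F" "{i. u i \<noteq> \<zero>\<^bsub>k\<^esub>} \<subseteq> S" for S u
    using that
  proof (induction S arbitrary: u)
    case empty
    then have "u = \<zero>\<^bsub>?F\<^esub>" by (auto simp: free_module_def)
    then show ?case using zero by simp
  next
    case (insert i S)
    note s = free_module_support[OF insert.prems(1)]
    show ?case
    proof (cases "i \<in> I")
      case False
      then have "{j. u j \<noteq> \<zero>\<^bsub>k\<^esub>} \<subseteq> S" using insert.prems s by auto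
      then show ?thesis using insert.IH insert.prems(1) by blast
    next
      case True
      let ?v = "u(i := \<zero>\<^bsub>k\<^esub>)"
      have "finite {j. ?v j \<noteq> \<zero>\<^bsub>k\<^esub>}"
        by (rule finite_subset[OF _ s(1)]) auto
      then have v: "?v \<in> carrier ?F"
        using insert.prems(1) unfolding free_module_def by auto
      have "{j. ?v j \<noteq> \<zero>\<^bsub>k\<^esub>} \<subseteq> S" using insert.prems(2) by auto
      then have "?v \<in> H" using insert.IH v by blast
      moreover have "u i \<odot>\<^bsub>?F\<^esub> free_gen k i \<in> H"
        using E(4) s(3)[OF True] assms(3)[OF True] by blast
      moreover have "u = u i \<odot>\<^bsub>?F\<^esub> free_gen k i \<oplus>\<^bsub>?F\<^esub> ?v"
      proof
        fix j
        have "u j \<in> carrier k" using s by (cases "u j = \<zero>\<^bsub>k\<^esub>") auto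
        then show "u j = (u i \<odot>\<^bsub>?F\<^esub> free_gen k i \<oplus>\<^bsub>?F\<^esub> ?v) j"
          using s(3)[OF True] by (auto simp: free_module_def free_gen_def)
      qed
      ultimately show ?thesis using E(5) by metis
    qed
  qed
  then show ?thesis using free_module_support(1) by blast
qed

text \<open>The elements \<^const>\<open>tensor_relations\<close> takes the span of. A linear map kills the relations as soon
  as it kills these.\<close>

definition tensor_relators ::
  "('k, 'm) ring_scheme \<Rightarrow> ('k, 'v, 'x) module_scheme \<Rightarrow> ('k, 'w, 'y) module_scheme
    \<Rightarrow> ('v \<times> 'w \<Rightarrow> 'k) set"
  where "tensor_relators k V W =
    (let F = free_module k (carrier V \<times> carrier W); d = (\<lambda>v w. free_gen k (v, w)) in
      ({d (v \<oplus>\<^bsub>V\<^esub> v') w \<ominus>\<^bsub>F\<^esub> (d v w \<oplus>\<^bsub>F\<^esub> d v' w) | v v' w.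
          v \<in> carrier V \<and> v' \<in> carrier V \<and> w \<in> carrier W} \<union>
       {d v (w \<oplus>\<^bsub>W\<^esub> w') \<ominus>\<^bsub>F\<^esub> (d v w \<oplus>\<^bsub>F\<^esub> d v w') | v w w'.
          v \<in> carrier V \<and> w \<in> carrier W \<and> w' \<in> carrier W} \<union>
       {d (a \<odot>\<^bsub>V\<^esub> v) w \<ominus>\<^bsub>F\<^esub> (a \<odot>\<^bsub>F\<^esub> d v w) | a v w.
          a \<in> carrier k \<and> v \<in> carrier V \<and> w \<in> carrier W} \<union>
       {d v (a \<odot>\<^bsub>W\<^esub> w) \<ominus>\<^bsub>F\<^esub> (a \<odot>\<^bsub>F\<^esub> d v w) | a v w.
          a \<in> carrier k \<and> v \<in> carrier V \<and> w \<in> carrier W}))"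

lemma tensor_relations_eq_span:
  "tensor_relations k V W =
    linear_span k (free_module k (carrier V \<times> carrier W)) (tensor_relators k V W)"
  unfolding tensor_relations_def tensor_relators_def Let_def ..

context
  fixes k :: "('k, 'm) ring_scheme"
    and V :: "('k, 'v, 'x) module_scheme" and W :: "('k, 'w, 'y) module_scheme"
  assumes V: "module k V" and W: "module k W"
begin

interpretation V: module k V by (rule V)
interpretation W: module k W by (rule W)

abbreviation (input) "formal_tensors \<equiv> free_module k (carrier V \<times> carrier W)"

interpretation F: module k formal_tensors
  by (rule free_module_is_module[OF V.R.cring_axioms])

lemma tensor_relators_subset: "tensor_relators k V W \<subseteq> carrier formal_tensors"
  unfolding tensor_relators_def Let_def
  by (auto intro!: F.M.minus_closed F.M.a_closed F.smult_closed free_gen_closed[OF V.R.cring_axioms])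

lemma tensor_relations_submodule: "submodule (tensor_relations k V W) k formal_tensors"
  unfolding tensor_relations_eq_span
  by (rule linear_span_submodule[OF F.module_axioms tensor_relators_subset])

lemma tensor_module_is_module: "module k (tensor_module k V W)"
  unfolding tensor_module_def
  by (rule quotient_module_is_module[OF F.module_axioms tensor_relations_submodule])

lemma tensor_bilinear: "tensor k V W \<in> bilinear_maps k V W (tensor_module k V W)"
proof -
  let ?N = "tensor_relations k V W"
  note N = F.module_axioms tensor_relations_submodule
  note gen = free_gen_closed[OF V.R.cring_axioms, of _ "carrier V \<times> carrier W"]
  have rel: "x \<in> ?N" if "x \<in> tensor_relators k V W" for x
    using that linear_span_incl unfolding tensor_relations_eq_span by fast
  have closed: "tensor k V W v w \<in> carrier (tensor_module k V W)"
    if "v \<in> carrier V" "w \<in> carrier W" for v w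
    unfolding tensor_def tensor_module_def quotient_module_carrier
    using gen that by blast
  show ?thesis
  proof (rule bilinear_mapsI; rule linear_mapsI)
    fix v w w' assume *: "v \<in> carrier V" "w \<in> carrier W" "w' \<in> carrier W"
    have "?N +>\<^bsub>formal_tensors\<^esub> free_gen k (v, w \<oplus>\<^bsub>W\<^esub> w')
        = ?N +>\<^bsub>formal_tensors\<^esub> (free_gen k (v, w) \<oplus>\<^bsub>formal_tensors\<^esub> free_gen k (v, w'))"
      by (rule quotient_module_eq[OF N]; (rule rel)?)
        (use * gen in \<open>auto simp: tensor_relators_def Let_def\<close>)
    then show "tensor k V W v (w \<oplus>\<^bsub>W\<^esub> w') =
        tensor k V W v w \<oplus>\<^bsub>tensor_module k V W\<^esub> tensor k V W v w'"
      unfolding tensor_def tensor_module_def using * gen by (simp add: quotient_module_add[OF N])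
  next
    fix v v' w assume *: "w \<in> carrier W" "v \<in> carrier V" "v' \<in> carrier V"
    have "?N +>\<^bsub>formal_tensors\<^esub> free_gen k (v \<oplus>\<^bsub>V\<^esub> v', w)
        = ?N +>\<^bsub>formal_tensors\<^esub> (free_gen k (v, w) \<oplus>\<^bsub>formal_tensors\<^esub> free_gen k (v', w))"
      by (rule quotient_module_eq[OF N]; (rule rel)?)
        (use * gen in \<open>auto simp: tensor_relators_def Let_def\<close>)
    then show "tensor k V W (v \<oplus>\<^bsub>V\<^esub> v') w =
        tensor k V W v w \<oplus>\<^bsub>tensor_module k V W\<^esub> tensor k V W v' w"
      unfolding tensor_def tensor_module_def using * gen by (simp add: quotient_module_add[OF N])
  next
    fix v a w assume *: "v \<in> carrier V" "a \<in> carrier k" "w \<in> carrier W"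
    have "?N +>\<^bsub>formal_tensors\<^esub> free_gen k (v, a \<odot>\<^bsub>W\<^esub> w) = ?N +>\<^bsub>formal_tensors\<^esub> (a \<odot>\<^bsub>formal_tensors\<^esub> free_gen k (v, w))"
      by (rule quotient_module_eq[OF N]; (rule rel)?)
        (use * gen in \<open>auto simp: tensor_relators_def Let_def\<close>)
    then show "tensor k V W v (a \<odot>\<^bsub>W\<^esub> w) = a \<odot>\<^bsub>tensor_module k V W\<^esub> tensor k V W v w"
      unfolding tensor_def tensor_module_def using * gen by (simp add: quotient_module_smult[OF N])
  next
    fix w a v assume *: "w \<in> carrier W" "a \<in> carrier k" "v \<in> carrier V"
    have "?N +>\<^bsub>formal_tensors\<^esub> free_gen k (a \<odot>\<^bsub>V\<^esub> v, w) = ?N +>\<^bsub>formal_tensors\<^esub> (a \<odot>\<^bsub>formal_tensors\<^esub> free_gen k (v, w))"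
      by (rule quotient_module_eq[OF N]; (rule rel)?)
        (use * gen in \<open>auto simp: tensor_relators_def Let_def\<close>)
    then show "tensor k V W (a \<odot>\<^bsub>V\<^esub> v) w = a \<odot>\<^bsub>tensor_module k V W\<^esub> tensor k V W v w"
      unfolding tensor_def tensor_module_def using * gen by (simp add: quotient_module_smult[OF N])
  qed (use closed in auto)
qed

lemma coset_linear:
  "(\<lambda>u. tensor_relations k V W +>\<^bsub>formal_tensors\<^esub> u) \<in> linear_maps k formal_tensors (tensor_module k V W)"
  unfolding tensor_module_def
  by (rule linear_mapsI)
    (simp_all add: quotient_module_carrier quotient_module_add[OF F.module_axioms tensor_relations_submodule]
      quotient_module_smult[OF F.module_axioms tensor_relations_submodule])

text \<open>Pulled back to formal combinations of pairs, the difference of two linear maps has a kernel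
  that is a submodule. It is everything as soon as it contains each pair.\<close>

lemma linear_maps_eq_on_tensors:
  assumes "module k U" "g \<in> linear_maps k (tensor_module k V W) U"
    "h \<in> linear_maps k (tensor_module k V W) U"
    and "\<And>v w. \<lbrakk>v \<in> carrier V; w \<in> carrier W\<rbrakk> \<Longrightarrow> g (tensor k V W v w) = h (tensor k V W v w)"
    and "t \<in> carrier (tensor_module k V W)"
  shows "g t = h t"
proof -
  interpret U: module k U by fact
  let ?q = "\<lambda>u. tensor_relations k V W +>\<^bsub>formal_tensors\<^esub> u"
  let ?D = "\<lambda>u. g (?q u) \<oplus>\<^bsub>U\<^esub> \<ominus>\<^bsub>U\<^esub> h (?q u)"
  note lg = linear_maps_compose[OF coset_linear assms(2)]
  note lh = linear_maps_compose[OF coset_linear assms(3)]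
  have D: "?D \<in> linear_maps k formal_tensors U"
    using linear_maps_add[OF assms(1) lg linear_maps_smult[OF assms(1) lh, of "\<ominus>\<^bsub>k\<^esub> \<one>\<^bsub>k\<^esub>"]]
      linear_mapsD(1)[OF lh]
    by (subst linear_maps_cong[OF F.module_axioms]) (auto simp: U.smult_l_minus)
  have "carrier formal_tensors \<subseteq> {u \<in> carrier formal_tensors. ?D u = \<zero>\<^bsub>U\<^esub>}"
  proof (rule free_module_subset_submodule[OF V.R.cring_axioms
        linear_maps_kernel_submodule[OF F.module_axioms assms(1) D]])
    fix p assume "p \<in> carrier V \<times> carrier W"
    then obtain v w where p: "p = (v, w)" "v \<in> carrier V" "w \<in> carrier W" by auto
    have "g (?q (free_gen k p)) = h (?q (free_gen k p))"
      using assms(4)[OF p(2,3)] unfolding tensor_def p(1) .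
    then show "free_gen k p \<in> {u \<in> carrier formal_tensors. ?D u = \<zero>\<^bsub>U\<^esub>}"
      using p free_gen_closed[OF V.R.cring_axioms, of p "carrier V \<times> carrier W"]
        linear_mapsD(1)[OF lh] by (simp add: U.M.r_neg)
  qed
  moreover obtain u where u: "u \<in> carrier formal_tensors" "t = ?q u"
    using assms(5) unfolding tensor_module_def quotient_module_carrier by auto
  ultimately have "g t \<oplus>\<^bsub>U\<^esub> \<ominus>\<^bsub>U\<^esub> h t = \<zero>\<^bsub>U\<^esub>"
    using linear_mapsD(1)[OF lh] by auto
  then show ?thesis
    using linear_mapsD(1)[OF assms(2)] linear_mapsD(1)[OF assms(3)] assms(5)
    by (metis U.M.minus_equality U.M.minus_minus U.M.a_inv_closed)
qed

text \<open>The representative that \<^const>\<open>tensor_lift\<close> chooses depends on the tensor alone. One formal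
  combination therefore serves for all \<open>\<beta>\<close>, so that lifts of different \<open>\<beta>\<close> can be compared term by
  term.\<close>

lemma tensor_lift_representative:
  assumes "t \<in> carrier (tensor_module k V W)"
  shows "\<exists>u\<in>carrier formal_tensors. t = tensor_relations k V W +>\<^bsub>formal_tensors\<^esub> u \<and>
    (\<forall>\<beta>. tensor_lift k U \<beta> t = free_lift k U (\<lambda>p. \<beta> (fst p) (snd p)) u)"
proof -
  interpret N: abelian_subgroup "tensor_relations k V W" formal_tensors
    by (rule submodule_abelian_subgroup[OF F.module_axioms tensor_relations_submodule])
  obtain u where u: "u \<in> carrier formal_tensors" "t = tensor_relations k V W +>\<^bsub>formal_tensors\<^esub> u"
    using assms unfolding tensor_module_def quotient_module_carrier by auto
  let ?u = "SOME u. u \<in> t"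
  have mem: "?u \<in> t" using N.a_rcos_self[OF u(1)] u(2) by (metis someI)
  show ?thesis
  proof (intro bexI conjI allI)
    show "?u \<in> carrier formal_tensors" using mem N.a_elemrcos_carrier[OF u(1)] u(2) by blast
    show "t = tensor_relations k V W +>\<^bsub>formal_tensors\<^esub> ?u"
      using N.a_repr_independence' u mem by blast
    show "tensor_lift k U \<beta> t = free_lift k U (\<lambda>p. \<beta> (fst p) (snd p)) ?u" for \<beta>
      unfolding tensor_lift_def free_lift_def Let_def ..
  qed
qed

text \<open>The universal property: the linear extension of a bilinear map to formal combinations of
  pairs kills the defining relations, so it is constant on each coset.\<close>

lemma tensor_lift_coset:
  assumes "module k U" "\<beta> \<in> bilinear_maps k V W U" "u \<in> carrier formal_tensors"
  shows "tensor_lift k U \<beta> (tensor_relations k V W +>\<^bsub>formal_tensors\<^esub> u)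
    = free_lift k U (\<lambda>p. \<beta> (fst p) (snd p)) u"
proof -
  interpret U: module k U by fact
  interpret N: abelian_subgroup "tensor_relations k V W" formal_tensors
    by (rule submodule_abelian_subgroup[OF F.module_axioms tensor_relations_submodule])
  let ?g = "\<lambda>p. \<beta> (fst p) (snd p)"
  let ?L = "free_lift k U ?g"
  have g: "?g \<in> carrier V \<times> carrier W \<rightarrow> carrier U"
    using bilinear_mapsD(3)[OF assms(2)] by auto
  note L = free_lift_linear[OF assms(1) g]
  note gen = free_gen_closed[OF V.R.cring_axioms, of _ "carrier V \<times> carrier W"]
  have Lgen: "?L (free_gen k (v, w)) = \<beta> v w" if "v \<in> carrier V" "w \<in> carrier W" for v w
    using free_lift_free_gen[OF assms(1) g, of "(v, w)"] that by simp
  have diff: "?L (x \<ominus>\<^bsub>formal_tensors\<^esub> y) = ?L x \<ominus>\<^bsub>U\<^esub> ?L y" if "x \<in> carrier formal_tensors" "y \<in> carrier formal_tensors" for x y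
    unfolding a_minus_def
    using linear_mapsD(2)[OF L that(1) F.M.a_inv_closed[OF that(2)]]
      linear_maps_minus[OF F.module_axioms assms(1) L that(2)] by simp
  have sub: "tensor_relators k V W \<subseteq> {x \<in> carrier formal_tensors. ?L x = \<zero>\<^bsub>U\<^esub>}"
  proof -
    note bl = linear_mapsD(2,3)[OF bilinear_mapsD(1)[OF assms(2)]]
      linear_mapsD(2,3)[OF bilinear_mapsD(2)[OF assms(2)]]
    have cancel: "y \<ominus>\<^bsub>U\<^esub> y = \<zero>\<^bsub>U\<^esub>" if "y \<in> carrier U" for y
      using that by (simp add: a_minus_def U.M.r_neg)
    have "?L x = \<zero>\<^bsub>U\<^esub>" if "x \<in> tensor_relators k V W" for x
      using that unfolding tensor_relators_def Let_def
      by (auto simp: diff gen Lgen linear_mapsD[OF L] bl bilinear_mapsD(3)[OF assms(2)] cancel)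
    then show ?thesis using tensor_relators_subset by blast
  qed
  have kills: "tensor_relations k V W \<subseteq> {x \<in> carrier formal_tensors. ?L x = \<zero>\<^bsub>U\<^esub>}"
    unfolding tensor_relations_eq_span
    by (rule linear_span_minimal[OF linear_maps_kernel_submodule[OF F.module_axioms assms(1) L] sub])
  have t: "tensor_relations k V W +>\<^bsub>formal_tensors\<^esub> u \<in> carrier (tensor_module k V W)"
    using linear_mapsD(1)[OF coset_linear assms(3)] .
  obtain v where v: "v \<in> carrier formal_tensors"
    "tensor_lift k U \<beta> (tensor_relations k V W +>\<^bsub>formal_tensors\<^esub> u) = ?L v"
    "tensor_relations k V W +>\<^bsub>formal_tensors\<^esub> u = tensor_relations k V W +>\<^bsub>formal_tensors\<^esub> v"
    using tensor_lift_representative[OF t] by blast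
  have "v \<oplus>\<^bsub>formal_tensors\<^esub> \<ominus>\<^bsub>formal_tensors\<^esub> u \<in> tensor_relations k V W"
    using N.a_rcos_module_imp[OF assms(3)] N.a_rcos_self[OF v(1)] v(3) by auto
  then have "?L (v \<ominus>\<^bsub>formal_tensors\<^esub> u) = \<zero>\<^bsub>U\<^esub>"
    using kills unfolding a_minus_def by auto
  then have "?L v \<ominus>\<^bsub>U\<^esub> ?L u = \<zero>\<^bsub>U\<^esub>" using diff v(1) assms(3) by simp
  then have "?L v = ?L u"
    using linear_mapsD(1)[OF L] v(1) assms(3) by (simp add: U.M.add.inv_solve_right' a_minus_def)
  then show ?thesis using v(2) by simp
qed

lemma tensor_lift_tensor:
  assumes "module k U" "\<beta> \<in> bilinear_maps k V W U" "v \<in> carrier V" "w \<in> carrier W"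
  shows "tensor_lift k U \<beta> (tensor k V W v w) = \<beta> v w"
proof -
  have g: "(\<lambda>p. \<beta> (fst p) (snd p)) \<in> carrier V \<times> carrier W \<rightarrow> carrier U"
    using bilinear_mapsD(3)[OF assms(2)] by auto
  show ?thesis
    unfolding tensor_def
    using tensor_lift_coset[OF assms(1,2) free_gen_closed[OF V.R.cring_axioms]]
      free_lift_free_gen[OF assms(1) g, of "(v, w)"] assms(3,4) by auto
qed

lemma tensor_lift_linear:
  assumes "module k U" "\<beta> \<in> bilinear_maps k V W U"
  shows "tensor_lift k U \<beta> \<in> linear_maps k (tensor_module k V W) U"
proof -
  have g: "(\<lambda>p. \<beta> (fst p) (snd p)) \<in> carrier V \<times> carrier W \<rightarrow> carrier U"
    using bilinear_mapsD(3)[OF assms(2)] by auto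
  note L = linear_mapsD[OF free_lift_linear[OF assms(1) g]]
  note q = linear_mapsD[OF coset_linear]
  have ex: "\<exists>u\<in>carrier formal_tensors. t = tensor_relations k V W +>\<^bsub>formal_tensors\<^esub> u"
    if "t \<in> carrier (tensor_module k V W)" for t
    using that unfolding tensor_module_def quotient_module_carrier by auto
  show ?thesis
  proof (rule linear_mapsI)
    fix s t assume "s \<in> carrier (tensor_module k V W)" "t \<in> carrier (tensor_module k V W)"
    then obtain u v where "u \<in> carrier formal_tensors" "s = tensor_relations k V W +>\<^bsub>formal_tensors\<^esub> u"
      "v \<in> carrier formal_tensors" "t = tensor_relations k V W +>\<^bsub>formal_tensors\<^esub> v"
      using ex by metis
    then show "tensor_lift k U \<beta> (s \<oplus>\<^bsub>tensor_module k V W\<^esub> t)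
        = tensor_lift k U \<beta> s \<oplus>\<^bsub>U\<^esub> tensor_lift k U \<beta> t"
      by (simp flip: q(2) add: tensor_lift_coset[OF assms] L(2))
  next
    fix s assume "s \<in> carrier (tensor_module k V W)"
    then obtain u where u: "u \<in> carrier formal_tensors" "s = tensor_relations k V W +>\<^bsub>formal_tensors\<^esub> u"
      using ex by metis
    then show "tensor_lift k U \<beta> s \<in> carrier U"
      using L(1) by (simp add: tensor_lift_coset[OF assms])
    fix a assume "a \<in> carrier k"
    with u show "tensor_lift k U \<beta> (a \<odot>\<^bsub>tensor_module k V W\<^esub> s) = a \<odot>\<^bsub>U\<^esub> tensor_lift k U \<beta> s"
      by (simp flip: q(3) add: tensor_lift_coset[OF assms] L(3))
  qed
qed

lemma tensor_lift_compose:
  assumes "module k U" "module k U'" "\<beta> \<in> bilinear_maps k V W U" "h \<in> linear_maps k U U'"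
    and "t \<in> carrier (tensor_module k V W)"
  shows "h (tensor_lift k U \<beta> t) = tensor_lift k U' (\<lambda>v w. h (\<beta> v w)) t"
proof -
  have b: "(\<lambda>v w. h (\<beta> v w)) \<in> bilinear_maps k V W U'"
    using bilinear_maps_compose[OF assms(3) linear_maps_id linear_maps_id assms(4)] .
  show ?thesis
    by (rule linear_maps_eq_on_tensors[OF assms(2)
          linear_maps_compose[OF tensor_lift_linear[OF assms(1,3)] assms(4)]
          tensor_lift_linear[OF assms(2) b] _ assms(5)])
      (simp add: tensor_lift_tensor assms b)
qed

lemma tensor_lift_cong:
  assumes "module k U" "t \<in> carrier (tensor_module k V W)"
    and "\<And>v w. \<lbrakk>v \<in> carrier V; w \<in> carrier W\<rbrakk> \<Longrightarrow> \<beta>' v w \<in> carrier U"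
    and "\<And>v w. \<lbrakk>v \<in> carrier V; w \<in> carrier W\<rbrakk> \<Longrightarrow> \<beta> v w = \<beta>' v w"
  shows "tensor_lift k U \<beta> t = tensor_lift k U \<beta>' t"
proof -
  interpret U: module k U by fact
  obtain u where u: "u \<in> carrier formal_tensors"
    "\<And>\<beta>. tensor_lift k U \<beta> t = free_lift k U (\<lambda>p. \<beta> (fst p) (snd p)) u"
    using tensor_lift_representative[OF assms(2)] by blast
  note s = free_module_support[OF u(1)]
  show ?thesis
    unfolding u(2) free_lift_def
    by (rule U.M.finsum_cong') (use s assms(3,4) in \<open>force simp: subset_iff\<close>)+
qed

text \<open>At a fixed tensor every lift is the same finite combination of values of the summand, so linear
  dependence of the summand on a parameter passes to the lift.\<close>

lemma tensor_lift_parameter_linear: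
  assumes "module k U" "t \<in> carrier (tensor_module k V W)"
    and "\<And>v w. \<lbrakk>v \<in> carrier V; w \<in> carrier W\<rbrakk> \<Longrightarrow> (\<lambda>x. \<gamma> x v w) \<in> linear_maps k X U"
  shows "(\<lambda>x. tensor_lift k U (\<gamma> x) t) \<in> linear_maps k X U"
proof -
  interpret U: module k U by fact
  obtain u where u: "u \<in> carrier formal_tensors"
    "\<And>\<beta>. tensor_lift k U \<beta> t = free_lift k U (\<lambda>p. \<beta> (fst p) (snd p)) u"
    using tensor_lift_representative[OF assms(2)] by blast
  note s = free_module_support[OF u(1)]
  let ?S = "{p. u p \<noteq> \<zero>\<^bsub>k\<^esub>}"
  have S: "fst p \<in> carrier V" "snd p \<in> carrier W" "u p \<in> carrier k" if "p \<in> ?S" for p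
    using that s by (cases p; auto simp: subset_iff)+
  note lin = linear_mapsD[OF assms(3)[OF S(1,2)]]
  have summand: "u p \<odot>\<^bsub>U\<^esub> \<gamma> x (fst p) (snd p) \<in> carrier U" if "x \<in> carrier X" "p \<in> ?S" for x p
    using lin(1) S(3) that by blast
  show ?thesis
    unfolding u(2) free_lift_def
  proof (rule linear_mapsI)
    fix x assume x: "x \<in> carrier X"
    show "(\<Oplus>\<^bsub>U\<^esub>p\<in>?S. u p \<odot>\<^bsub>U\<^esub> \<gamma> x (fst p) (snd p)) \<in> carrier U"
      using summand[OF x] by (intro U.M.finsum_closed) blast
    fix a assume a: "a \<in> carrier k"
    have "(\<Oplus>\<^bsub>U\<^esub>p\<in>?S. u p \<odot>\<^bsub>U\<^esub> \<gamma> (a \<odot>\<^bsub>X\<^esub> x) (fst p) (snd p))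
        = (\<Oplus>\<^bsub>U\<^esub>p\<in>?S. a \<odot>\<^bsub>U\<^esub> (u p \<odot>\<^bsub>U\<^esub> \<gamma> x (fst p) (snd p)))"
    proof (rule U.M.finsum_cong'[OF refl])
      show "(\<lambda>p. a \<odot>\<^bsub>U\<^esub> (u p \<odot>\<^bsub>U\<^esub> \<gamma> x (fst p) (snd p))) \<in> ?S \<rightarrow> carrier U"
        using summand[OF x] a by blast
      fix p assume p: "p \<in> ?S"
      show "u p \<odot>\<^bsub>U\<^esub> \<gamma> (a \<odot>\<^bsub>X\<^esub> x) (fst p) (snd p) = a \<odot>\<^bsub>U\<^esub> (u p \<odot>\<^bsub>U\<^esub> \<gamma> x (fst p) (snd p))"
        using lin(1)[OF p p x] S(3)[OF p] a
        by (simp add: lin(3)[OF p p a x] V.R.m_comm flip: U.smult_assoc1)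
    qed
    also have "\<dots> = a \<odot>\<^bsub>U\<^esub> (\<Oplus>\<^bsub>U\<^esub>p\<in>?S. u p \<odot>\<^bsub>U\<^esub> \<gamma> x (fst p) (snd p))"
      by (rule U.finsum_smult_ldistr[symmetric]) (use s(1) a summand[OF x] in blast)+
    finally show "(\<Oplus>\<^bsub>U\<^esub>p\<in>?S. u p \<odot>\<^bsub>U\<^esub> \<gamma> (a \<odot>\<^bsub>X\<^esub> x) (fst p) (snd p))
        = a \<odot>\<^bsub>U\<^esub> (\<Oplus>\<^bsub>U\<^esub>p\<in>?S. u p \<odot>\<^bsub>U\<^esub> \<gamma> x (fst p) (snd p))" .
  next
    fix x y assume xy: "x \<in> carrier X" "y \<in> carrier X"
    have "(\<Oplus>\<^bsub>U\<^esub>p\<in>?S. u p \<odot>\<^bsub>U\<^esub> \<gamma> (x \<oplus>\<^bsub>X\<^esub> y) (fst p) (snd p))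
        = (\<Oplus>\<^bsub>U\<^esub>p\<in>?S. u p \<odot>\<^bsub>U\<^esub> \<gamma> x (fst p) (snd p) \<oplus>\<^bsub>U\<^esub> u p \<odot>\<^bsub>U\<^esub> \<gamma> y (fst p) (snd p))"
    proof (rule U.M.finsum_cong'[OF refl])
      show "(\<lambda>p. u p \<odot>\<^bsub>U\<^esub> \<gamma> x (fst p) (snd p) \<oplus>\<^bsub>U\<^esub> u p \<odot>\<^bsub>U\<^esub> \<gamma> y (fst p) (snd p)) \<in> ?S \<rightarrow> carrier U"
        using summand[OF xy(1)] summand[OF xy(2)] by blast
      fix p assume p: "p \<in> ?S"
      show "u p \<odot>\<^bsub>U\<^esub> \<gamma> (x \<oplus>\<^bsub>X\<^esub> y) (fst p) (snd p)
          = u p \<odot>\<^bsub>U\<^esub> \<gamma> x (fst p) (snd p) \<oplus>\<^bsub>U\<^esub> u p \<odot>\<^bsub>U\<^esub> \<gamma> y (fst p) (snd p)"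
        using lin(1)[OF p p xy(1)] lin(1)[OF p p xy(2)] S(3)[OF p]
        by (simp add: lin(2)[OF p p xy] U.smult_r_distr)
    qed
    also have "\<dots> = (\<Oplus>\<^bsub>U\<^esub>p\<in>?S. u p \<odot>\<^bsub>U\<^esub> \<gamma> x (fst p) (snd p))
        \<oplus>\<^bsub>U\<^esub> (\<Oplus>\<^bsub>U\<^esub>p\<in>?S. u p \<odot>\<^bsub>U\<^esub> \<gamma> y (fst p) (snd p))"
      by (rule U.M.finsum_addf) (use summand[OF xy(1)] summand[OF xy(2)] in blast)+
    finally show "(\<Oplus>\<^bsub>U\<^esub>p\<in>?S. u p \<odot>\<^bsub>U\<^esub> \<gamma> (x \<oplus>\<^bsub>X\<^esub> y) (fst p) (snd p))
        = (\<Oplus>\<^bsub>U\<^esub>p\<in>?S. u p \<odot>\<^bsub>U\<^esub> \<gamma> x (fst p) (snd p))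
        \<oplus>\<^bsub>U\<^esub> (\<Oplus>\<^bsub>U\<^esub>p\<in>?S. u p \<odot>\<^bsub>U\<^esub> \<gamma> y (fst p) (snd p))" .
  qed
qed

end

section \<open>Convolution algebras\<close>

text \<open>The algebra of linear maps \<open>C \<rightarrow> R\<close>. Its elements are extended by \<^const>\<open>undefined\<close> outside
  the carrier of \<open>C\<close>, so that two maps agreeing on \<open>C\<close> are equal.\<close>

definition conv_algebra ::
  "('k, 'm) ring_scheme \<Rightarrow> ('k, 'c, 'x) coalgebra_scheme \<Rightarrow> ('k, 'r, 'y) module_scheme
    \<Rightarrow> ('k, 'c \<Rightarrow> 'r) module"
  where "conv_algebra k C R =
    \<lparr>carrier = linear_maps k C R \<inter> extensional (carrier C),
     mult = (\<lambda>g h. \<lambda>c\<in>carrier C. sweedler k C R (\<lambda>x y. g x \<otimes>\<^bsub>R\<^esub> h y) c),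
     one = (\<lambda>c\<in>carrier C. counit C c \<odot>\<^bsub>R\<^esub> \<one>\<^bsub>R\<^esub>),
     zero = (\<lambda>c\<in>carrier C. \<zero>\<^bsub>R\<^esub>),
     add = (\<lambda>g h. \<lambda>c\<in>carrier C. g c \<oplus>\<^bsub>R\<^esub> h c),
     smult = (\<lambda>a g. \<lambda>c\<in>carrier C. a \<odot>\<^bsub>R\<^esub> g c)\<rparr>"

lemma conv_algebra_simps:
  "carrier (conv_algebra k C R) = linear_maps k C R \<inter> extensional (carrier C)"
  "g \<otimes>\<^bsub>conv_algebra k C R\<^esub> h = (\<lambda>c\<in>carrier C. sweedler k C R (\<lambda>x y. g x \<otimes>\<^bsub>R\<^esub> h y) c)"
  "\<one>\<^bsub>conv_algebra k C R\<^esub> = (\<lambda>c\<in>carrier C. counit C c \<odot>\<^bsub>R\<^esub> \<one>\<^bsub>R\<^esub>)"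
  "\<zero>\<^bsub>conv_algebra k C R\<^esub> = (\<lambda>c\<in>carrier C. \<zero>\<^bsub>R\<^esub>)"
  "g \<oplus>\<^bsub>conv_algebra k C R\<^esub> h = (\<lambda>c\<in>carrier C. g c \<oplus>\<^bsub>R\<^esub> h c)"
  "a \<odot>\<^bsub>conv_algebra k C R\<^esub> g = (\<lambda>c\<in>carrier C. a \<odot>\<^bsub>R\<^esub> g c)"
  by (simp_all add: conv_algebra_def)

lemma restrict_linear:
  assumes "module k V"
  shows "restrict g (carrier V) \<in> linear_maps k V W \<longleftrightarrow> g \<in> linear_maps k V W"
  by (rule linear_maps_cong[OF assms]) simp

context coalgebra
begin

lemma C_module: "module k C"
  by (rule module_axioms)

lemma tensor_square_module: "module k (tensor_module k C C)"
  by (rule tensor_module_is_module[OF C_module C_module])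

lemma comult_closed: "c \<in> carrier C \<Longrightarrow> comult C c \<in> carrier (tensor_module k C C)"
  using linear_mapsD(1)[OF comult_linear] .

lemma sweedler_linear:
  assumes "module k U" "\<beta> \<in> bilinear_maps k C C U"
  shows "sweedler k C U \<beta> \<in> linear_maps k C U"
  unfolding sweedler_def
  using linear_maps_compose[OF comult_linear tensor_lift_linear[OF C_module C_module assms]] .

lemma sweedler_compose:
  assumes "module k U" "module k U'" "\<beta> \<in> bilinear_maps k C C U" "h \<in> linear_maps k U U'"
    and "c \<in> carrier C"
  shows "h (sweedler k C U \<beta> c) = sweedler k C U' (\<lambda>x y. h (\<beta> x y)) c"
  unfolding sweedler_def
  by (rule tensor_lift_compose[OF C_module C_module assms(1-4) comult_closed[OF assms(5)]])

lemma sweedler_cong: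
  assumes "module k U" "c \<in> carrier C"
    and "\<And>x y. \<lbrakk>x \<in> carrier C; y \<in> carrier C\<rbrakk> \<Longrightarrow> \<beta>' x y \<in> carrier U"
    and "\<And>x y. \<lbrakk>x \<in> carrier C; y \<in> carrier C\<rbrakk> \<Longrightarrow> \<beta> x y = \<beta>' x y"
  shows "sweedler k C U \<beta> c = sweedler k C U \<beta>' c"
  unfolding sweedler_def
  by (rule tensor_lift_cong[OF C_module C_module assms(1) comult_closed[OF assms(2)] assms(3,4)])

lemma sweedler_parameter_linear:
  assumes "module k U" "c \<in> carrier C"
    and "\<And>v w. \<lbrakk>v \<in> carrier C; w \<in> carrier C\<rbrakk> \<Longrightarrow> (\<lambda>x. \<gamma> x v w) \<in> linear_maps k X U"
  shows "(\<lambda>x. sweedler k C U (\<gamma> x) c) \<in> linear_maps k X U"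
  unfolding sweedler_def
  by (rule tensor_lift_parameter_linear[OF C_module C_module assms(1) comult_closed[OF assms(2)] assms(3)])

text \<open>Coassociativity in Sweedler form: apply to both sides of the axiom the linear map that a
  trilinear \<open>\<gamma>\<close> induces on \<open>C \<otimes> (C \<otimes> C)\<close>.\<close>

lemma sweedler_coassociative:
  assumes U: "module k U" and c: "c \<in> carrier C"
    and g1: "\<And>y z. \<lbrakk>y \<in> carrier C; z \<in> carrier C\<rbrakk> \<Longrightarrow> (\<lambda>x. \<gamma> x y z) \<in> linear_maps k C U"
    and g2: "\<And>x z. \<lbrakk>x \<in> carrier C; z \<in> carrier C\<rbrakk> \<Longrightarrow> (\<lambda>y. \<gamma> x y z) \<in> linear_maps k C U"
    and g3: "\<And>x y. \<lbrakk>x \<in> carrier C; y \<in> carrier C\<rbrakk> \<Longrightarrow> \<gamma> x y \<in> linear_maps k C U"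
  shows "sweedler k C U (\<lambda>x z. sweedler k C U (\<lambda>u v. \<gamma> u v z) x) c
    = sweedler k C U (\<lambda>x y. sweedler k C U (\<gamma> x) y) c"
proof -
  let ?T = "tensor_module k C C"
  let ?R = "tensor_module k C ?T"
  let ?L = "tensor_module k ?T C"
  note C = C_module and T = tensor_square_module
  have R: "module k ?R" by (rule tensor_module_is_module[OF C T])
  have L: "module k ?L" by (rule tensor_module_is_module[OF T C])
  note tR = tensor_bilinear[OF C T] and tL = tensor_bilinear[OF T C]
    and tT = tensor_bilinear[OF C C]
  have gb: "\<gamma> x \<in> bilinear_maps k C C U" if "x \<in> carrier C" for x
    by (rule bilinear_mapsI) (use g2 g3 that in auto)
  have gb': "(\<lambda>u v. \<gamma> u v z) \<in> bilinear_maps k C C U" if "z \<in> carrier C" for z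
    by (rule bilinear_mapsI) (use g1 g2 that in auto)
  have Gb: "(\<lambda>x. tensor_lift k U (\<gamma> x)) \<in> bilinear_maps k C ?T U"
    by (rule bilinear_mapsI)
      (use tensor_lift_linear[OF C C U gb] tensor_lift_parameter_linear[OF C C U] g1 in auto)
  let ?G = "tensor_lift k U (\<lambda>x. tensor_lift k U (\<gamma> x))"
  note G = tensor_lift_linear[OF C T U Gb]
  have Gt: "?G (tensor k C ?T x (tensor k C C y z)) = \<gamma> x y z"
    if "x \<in> carrier C" "y \<in> carrier C" "z \<in> carrier C" for x y z
    using that by (simp add: tensor_lift_tensor[OF C T U Gb] tensor_lift_tensor[OF C C U gb]
        bilinear_mapsD(3)[OF tT])
  let ?a = "\<lambda>t z. tensor_lift k ?R (\<lambda>x y. tensor k C ?T x (tensor k C C y z)) t"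
  have ab0: "(\<lambda>x y. tensor k C ?T x (tensor k C C y z)) \<in> bilinear_maps k C C ?R"
    if "z \<in> carrier C" for z
    using bilinear_maps_compose[OF tR linear_maps_id bilinear_mapsD(2)[OF tT that] linear_maps_id] .
  have ab: "?a \<in> bilinear_maps k ?T C ?R"
  proof (rule bilinear_mapsI)
    fix t assume t: "t \<in> carrier ?T"
    show "?a t \<in> linear_maps k C ?R"
      by (rule tensor_lift_parameter_linear[OF C C R t])
        (rule linear_maps_compose[OF bilinear_mapsD(1)[OF tT] bilinear_mapsD(1)[OF tR]])
  next
    fix z assume "z \<in> carrier C"
    then show "(\<lambda>t. ?a t z) \<in> linear_maps k ?T ?R"
      using tensor_lift_linear[OF C C R ab0] by simp
  qed
  note A = tensor_lift_linear[OF T C R ab]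
  have d1: "(\<lambda>v w. tensor k ?T C (comult C v) (id w)) \<in> bilinear_maps k C C ?L"
    using bilinear_maps_compose[OF tL comult_linear linear_maps_id linear_maps_id] by simp
  have d2: "(\<lambda>v w. tensor k C ?T (id v) (comult C w)) \<in> bilinear_maps k C C ?R"
    using bilinear_maps_compose[OF tR linear_maps_id comult_linear linear_maps_id] by simp
  note dc = comult_closed
  have "?G (tensor_assoc k C C C (tensor_map k ?T C (comult C) id (comult C c)))
      = tensor_lift k U (\<lambda>v w. ?G (tensor_lift k ?R ?a (tensor k ?T C (comult C v) (id w)))) (comult C c)"
    unfolding tensor_assoc_def tensor_map_def Let_def
    by (rule tensor_lift_compose[OF C C L U d1 linear_maps_compose[OF A G] dc[OF c]])
  also have "\<dots> = tensor_lift k U (\<lambda>x z. sweedler k C U (\<lambda>u v. \<gamma> u v z) x) (comult C c)"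
  proof (rule tensor_lift_cong[OF C C U dc[OF c]])
    fix x z assume x: "x \<in> carrier C" and z: "z \<in> carrier C"
    show "sweedler k C U (\<lambda>u v. \<gamma> u v z) x \<in> carrier U"
      using linear_mapsD(1)[OF sweedler_linear[OF U gb'[OF z]] x] .
    have "?G (tensor_lift k ?R ?a (tensor k ?T C (comult C x) (id z))) = ?G (?a (comult C x) z)"
      using tensor_lift_tensor[OF T C R ab dc[OF x] z] by simp
    also have "\<dots> = tensor_lift k U (\<lambda>u v. ?G (tensor k C ?T u (tensor k C C v z))) (comult C x)"
      by (rule tensor_lift_compose[OF C C R U ab0[OF z] G dc[OF x]])
    also have "\<dots> = sweedler k C U (\<lambda>u v. \<gamma> u v z) x"
      unfolding sweedler_def
      by (rule tensor_lift_cong[OF C C U dc[OF x]])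
        (simp_all add: Gt z bilinear_mapsD(3)[OF gb'[OF z]])
    finally show "?G (tensor_lift k ?R ?a (tensor k ?T C (comult C x) (id z)))
        = sweedler k C U (\<lambda>u v. \<gamma> u v z) x" .
  qed
  finally have l: "?G (tensor_assoc k C C C (tensor_map k ?T C (comult C) id (comult C c)))
      = sweedler k C U (\<lambda>x z. sweedler k C U (\<lambda>u v. \<gamma> u v z) x) c"
    by (simp add: sweedler_def)
  have "?G (tensor_map k C ?T id (comult C) (comult C c))
      = tensor_lift k U (\<lambda>v w. ?G (tensor k C ?T (id v) (comult C w))) (comult C c)"
    unfolding tensor_map_def
    by (rule tensor_lift_compose[OF C C R U d2 G dc[OF c]])
  also have "\<dots> = tensor_lift k U (\<lambda>x y. sweedler k C U (\<gamma> x) y) (comult C c)"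
    by (rule tensor_lift_cong[OF C C U dc[OF c]])
      (simp_all add: tensor_lift_tensor[OF C T U Gb] dc linear_mapsD(1)[OF sweedler_linear[OF U gb]]
        flip: sweedler_def)
  finally have r: "?G (tensor_map k C ?T id (comult C) (comult C c))
      = sweedler k C U (\<lambda>x y. sweedler k C U (\<gamma> x) y) c"
    by (simp add: sweedler_def)
  show ?thesis
    using l r coassociative[OF c] by simp
qed

lemma counit_closed: "c \<in> carrier C \<Longrightarrow> counit C c \<in> carrier k"
  and counit_add: "\<lbrakk>c \<in> carrier C; d \<in> carrier C\<rbrakk> \<Longrightarrow>
    counit C (c \<oplus>\<^bsub>C\<^esub> d) = counit C c \<oplus>\<^bsub>k\<^esub> counit C d"
  and counit_smult: "\<lbrakk>a \<in> carrier k; c \<in> carrier C\<rbrakk> \<Longrightarrow>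
    counit C (a \<odot>\<^bsub>C\<^esub> c) = a \<otimes>\<^bsub>k\<^esub> counit C c"
  using linear_mapsD[OF counit_linear] by (simp_all add: scalar_module_def)

lemma counit_multiple_linear:
  assumes "module k U" "u \<in> carrier U"
  shows "(\<lambda>c. counit C c \<odot>\<^bsub>U\<^esub> u) \<in> linear_maps k C U"
proof -
  interpret U: module k U by fact
  show ?thesis
    by (rule linear_mapsI)
      (simp_all add: counit_closed counit_add counit_smult assms(2) U.smult_l_distr U.smult_assoc1)
qed

text \<open>Both counit axioms, transported along the linear map \<open>g\<close>.\<close>

lemma sweedler_counit:
  assumes U: "module k U" and g: "g \<in> linear_maps k C U" and c: "c \<in> carrier C"
  shows "sweedler k C U (\<lambda>x y. counit C x \<odot>\<^bsub>U\<^esub> g y) c = g c"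
    and "sweedler k C U (\<lambda>x y. counit C y \<odot>\<^bsub>U\<^esub> g x) c = g c"
proof -
  interpret U: module k U by fact
  have b: "(\<lambda>x y. counit C x \<odot>\<^bsub>C\<^esub> y) \<in> bilinear_maps k C C C"
    "(\<lambda>x y. counit C y \<odot>\<^bsub>C\<^esub> x) \<in> bilinear_maps k C C C"
    by (rule bilinear_mapsI;
        (rule counit_multiple_linear linear_maps_smult linear_maps_id C_module counit_closed | assumption)+)+
  have "sweedler k C U (\<lambda>x y. counit C x \<odot>\<^bsub>U\<^esub> g y) c = sweedler k C U (\<lambda>x y. g (counit C x \<odot>\<^bsub>C\<^esub> y)) c"
    by (rule sweedler_cong[OF U c]) (simp_all add: linear_mapsD[OF g] counit_closed)
  also have "\<dots> = g c"
    using sweedler_compose[OF C_module U b(1) g c] counit_left[OF c] by simp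
  finally show "sweedler k C U (\<lambda>x y. counit C x \<odot>\<^bsub>U\<^esub> g y) c = g c" .
  have "sweedler k C U (\<lambda>x y. counit C y \<odot>\<^bsub>U\<^esub> g x) c = sweedler k C U (\<lambda>x y. g (counit C y \<odot>\<^bsub>C\<^esub> x)) c"
    by (rule sweedler_cong[OF U c]) (simp_all add: linear_mapsD[OF g] counit_closed)
  also have "\<dots> = g c"
    using sweedler_compose[OF C_module U b(2) g c] counit_right[OF c] by simp
  finally show "sweedler k C U (\<lambda>x y. counit C y \<odot>\<^bsub>U\<^esub> g x) c = g c" .
qed

end

lemma (in unital_algebra) mult_bilinear: "mult A \<in> bilinear_maps k A A A"
  by (intro bilinear_mapsI linear_mapsI)
    (simp_all add: smult_mult_left smult_mult_right l_distr r_distr)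

locale convolution = coalgebra k C + R: unital_algebra k R
  for k :: "('k, 'm) ring_scheme" and C :: "('k, 'c, 'x) coalgebra_scheme"
    and R :: "('k, 'r, 'y) module_scheme"
begin

lemma R_module: "module k R"
  by (rule R.module_axioms)

lemma product_bilinear:
  assumes "g \<in> linear_maps k C R" "h \<in> linear_maps k C R"
  shows "(\<lambda>x y. g x \<otimes>\<^bsub>R\<^esub> h y) \<in> bilinear_maps k C C R"
  using bilinear_maps_compose[OF R.mult_bilinear assms linear_maps_id] .

lemma conv_algebra_mult_closed:
  assumes "g \<in> linear_maps k C R" "h \<in> linear_maps k C R"
  shows "g \<otimes>\<^bsub>conv_algebra k C R\<^esub> h \<in> carrier (conv_algebra k C R)"
  using sweedler_linear[OF R_module product_bilinear[OF assms]]
  by (simp add: conv_algebra_simps restrict_linear[OF C_module])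

lemma conv_algebra_module: "module k (conv_algebra k C R)"
proof -
  let ?E = "conv_algebra k C R"
  note s = conv_algebra_simps restrict_linear[OF C_module]
  have add: "g \<oplus>\<^bsub>?E\<^esub> h \<in> carrier ?E" if "g \<in> carrier ?E" "h \<in> carrier ?E" for g h
    using that by (auto simp: s intro!: linear_maps_add[OF R_module])
  have smult: "a \<odot>\<^bsub>?E\<^esub> g \<in> carrier ?E" if "a \<in> carrier k" "g \<in> carrier ?E" for g a
    using that by (auto simp: s intro!: linear_maps_smult[OF R_module])
  have val: "g c \<in> carrier R" if "g \<in> carrier ?E" "c \<in> carrier C" for g c
    using that linear_mapsD(1) by (fastforce simp: s)
  have ext: "g = h" if "g \<in> carrier ?E" "h \<in> carrier ?E" "\<And>c. c \<in> carrier C \<Longrightarrow> g c = h c" for g h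
    using that by (auto simp: s intro: extensionalityI)
  have z: "\<zero>\<^bsub>?E\<^esub> \<in> carrier ?E"
    by (auto simp: s intro!: linear_maps_const_zero[OF R_module])
  show ?thesis
  proof (rule moduleI)
    show "abelian_group ?E"
    proof (rule abelian_groupI)
      fix g assume g: "g \<in> carrier ?E"
      have "(\<ominus>\<^bsub>k\<^esub> \<one>\<^bsub>k\<^esub>) \<odot>\<^bsub>?E\<^esub> g \<in> carrier ?E" using smult g by simp
      moreover have "(\<ominus>\<^bsub>k\<^esub> \<one>\<^bsub>k\<^esub>) \<odot>\<^bsub>?E\<^esub> g \<oplus>\<^bsub>?E\<^esub> g = \<zero>\<^bsub>?E\<^esub>"
        using val[OF g] by (auto simp: s R.smult_l_minus R.l_neg)
      ultimately show "\<exists>y\<in>carrier ?E. y \<oplus>\<^bsub>?E\<^esub> g = \<zero>\<^bsub>?E\<^esub>" by blast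
      show "\<zero>\<^bsub>?E\<^esub> \<oplus>\<^bsub>?E\<^esub> g = g"
        by (rule ext[OF add[OF z g] g]) (use val[OF g] in \<open>simp add: s\<close>)
      fix h assume h: "h \<in> carrier ?E"
      show "g \<oplus>\<^bsub>?E\<^esub> h \<in> carrier ?E" by (rule add[OF g h])
      show "g \<oplus>\<^bsub>?E\<^esub> h = h \<oplus>\<^bsub>?E\<^esub> g"
        by (rule ext[OF add[OF g h] add[OF h g]]) (use val[OF g] val[OF h] in \<open>simp add: s R.a_comm\<close>)
      fix l assume l: "l \<in> carrier ?E"
      show "g \<oplus>\<^bsub>?E\<^esub> h \<oplus>\<^bsub>?E\<^esub> l = g \<oplus>\<^bsub>?E\<^esub> (h \<oplus>\<^bsub>?E\<^esub> l)"
        by (rule ext[OF add[OF add[OF g h] l] add[OF g add[OF h l]]])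
          (use val[OF g] val[OF h] val[OF l] in \<open>simp add: s R.a_assoc\<close>)
    qed (rule z)
    fix a g assume a: "a \<in> carrier k" and g: "g \<in> carrier ?E"
    show "a \<odot>\<^bsub>?E\<^esub> g \<in> carrier ?E" by (rule smult[OF a g])
    fix h assume h: "h \<in> carrier ?E"
    show "a \<odot>\<^bsub>?E\<^esub> (g \<oplus>\<^bsub>?E\<^esub> h) = a \<odot>\<^bsub>?E\<^esub> g \<oplus>\<^bsub>?E\<^esub> a \<odot>\<^bsub>?E\<^esub> h"
      by (rule ext[OF smult[OF a add[OF g h]] add[OF smult[OF a g] smult[OF a h]]])
        (use a val[OF g] val[OF h] in \<open>simp add: s R.smult_r_distr\<close>)
  next
    fix a b g assume a: "a \<in> carrier k" and b: "b \<in> carrier k" and g: "g \<in> carrier ?E"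
    show "(a \<oplus>\<^bsub>k\<^esub> b) \<odot>\<^bsub>?E\<^esub> g = a \<odot>\<^bsub>?E\<^esub> g \<oplus>\<^bsub>?E\<^esub> b \<odot>\<^bsub>?E\<^esub> g"
      by (rule ext[OF smult[OF _ g] add[OF smult[OF a g] smult[OF b g]]])
        (use a b val[OF g] in \<open>simp_all add: s R.smult_l_distr\<close>)
    show "(a \<otimes>\<^bsub>k\<^esub> b) \<odot>\<^bsub>?E\<^esub> g = a \<odot>\<^bsub>?E\<^esub> (b \<odot>\<^bsub>?E\<^esub> g)"
      by (rule ext[OF smult[OF _ g] smult[OF a smult[OF b g]]])
        (use a b val[OF g] in \<open>simp_all add: s R.smult_assoc1\<close>)
  next
    fix g assume g: "g \<in> carrier ?E"
    show "\<one>\<^bsub>k\<^esub> \<odot>\<^bsub>?E\<^esub> g = g"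
      by (rule ext[OF smult[OF _ g] g]) (use val[OF g] in \<open>simp_all add: s\<close>)
  qed (rule module.axioms(1)[OF C_module])
qed

lemma evaluation_linear:
  assumes "c \<in> carrier C"
  shows "(\<lambda>g. g c) \<in> linear_maps k (conv_algebra k C R) R"
  by (rule linear_mapsI) (use assms linear_mapsD(1) in \<open>auto simp: conv_algebra_simps\<close>)

text \<open>The value of a product at \<open>c\<close> is a Sweedler sum whose summand is linear in either factor, since
  evaluation at a point is linear.\<close>

lemma conv_algebra_mult_bilinear:
  "mult (conv_algebra k C R) \<in>
    bilinear_maps k (conv_algebra k C R) (conv_algebra k C R) (conv_algebra k C R)"
proof -
  let ?E = "conv_algebra k C R"
  note s = conv_algebra_simps
  have closed: "g \<otimes>\<^bsub>?E\<^esub> h \<in> carrier ?E" if "g \<in> carrier ?E" "h \<in> carrier ?E" for g h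
    using that conv_algebra_mult_closed by (auto simp: s(1))
  interpret E: module k ?E by (rule conv_algebra_module)
  \<comment> \<open>A map into the convolution algebra is linear as soon as all its evaluations are.\<close>
  have lin: "\<Psi> \<in> linear_maps k ?E ?E"
    if "\<And>g. g \<in> carrier ?E \<Longrightarrow> \<Psi> g \<in> carrier ?E"
      "\<And>c. c \<in> carrier C \<Longrightarrow> (\<lambda>g. \<Psi> g c) \<in> linear_maps k ?E R" for \<Psi>
  proof (rule linear_mapsI)
    fix g h assume gh: "g \<in> carrier ?E" "h \<in> carrier ?E"
    have "\<Psi> (g \<oplus>\<^bsub>?E\<^esub> h) \<in> extensional (carrier C)"
      using that(1)[OF E.M.a_closed[OF gh]] by (simp add: s(1))
    then show "\<Psi> (g \<oplus>\<^bsub>?E\<^esub> h) = \<Psi> g \<oplus>\<^bsub>?E\<^esub> \<Psi> h"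
      by (rule extensionalityI)
        (use linear_mapsD(2)[OF that(2) gh] in \<open>simp_all add: s(5)\<close>)
  next
    fix a g assume ag: "a \<in> carrier k" "g \<in> carrier ?E"
    have "\<Psi> (a \<odot>\<^bsub>?E\<^esub> g) \<in> extensional (carrier C)"
      using that(1)[OF E.smult_closed[OF ag]] by (simp add: s(1))
    then show "\<Psi> (a \<odot>\<^bsub>?E\<^esub> g) = a \<odot>\<^bsub>?E\<^esub> \<Psi> g"
      by (rule extensionalityI)
        (use linear_mapsD(3)[OF that(2) ag] in \<open>simp_all add: s(6)\<close>)
  qed (rule that(1))
  have val: "g c \<in> carrier R" if "g \<in> carrier ?E" "c \<in> carrier C" for g c
    using linear_mapsD(1)[OF evaluation_linear] that by blast
  show ?thesis
  proof (rule bilinear_mapsI; rule lin)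
    fix g c assume g: "g \<in> carrier ?E" and c: "c \<in> carrier C"
    have "(\<lambda>h. sweedler k C R (\<lambda>x y. g x \<otimes>\<^bsub>R\<^esub> h y) c) \<in> linear_maps k ?E R"
      by (rule sweedler_parameter_linear[OF R_module c])
        (rule linear_maps_compose[OF evaluation_linear bilinear_mapsD(1)[OF R.mult_bilinear val[OF g]]])
    then show "(\<lambda>h. (g \<otimes>\<^bsub>?E\<^esub> h) c) \<in> linear_maps k ?E R" using c by (simp add: s(2))
    have "(\<lambda>h. sweedler k C R (\<lambda>x y. h x \<otimes>\<^bsub>R\<^esub> g y) c) \<in> linear_maps k ?E R"
      by (rule sweedler_parameter_linear[OF R_module c])
        (rule linear_maps_compose[OF evaluation_linear bilinear_mapsD(2)[OF R.mult_bilinear val[OF g]]])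
    then show "(\<lambda>h. (h \<otimes>\<^bsub>?E\<^esub> g) c) \<in> linear_maps k ?E R" using c by (simp add: s(2))
  qed (use closed in auto)
qed

text \<open>The two bracketings are the two iterated Sweedler sums of \<open>g(x) h(y) l(z)\<close>, which agree by
  coassociativity.\<close>

lemma conv_algebra_mult_assoc:
  assumes "g \<in> linear_maps k C R" "h \<in> linear_maps k C R" "l \<in> linear_maps k C R"
  shows "(g \<otimes>\<^bsub>conv_algebra k C R\<^esub> h) \<otimes>\<^bsub>conv_algebra k C R\<^esub> l
    = g \<otimes>\<^bsub>conv_algebra k C R\<^esub> (h \<otimes>\<^bsub>conv_algebra k C R\<^esub> l)"
proof -
  let ?E = "conv_algebra k C R"
  note g = linear_mapsD(1)[OF assms(1)] and h = linear_mapsD(1)[OF assms(2)]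
    and l = linear_mapsD(1)[OF assms(3)]
  note m1 = bilinear_mapsD(1)[OF R.mult_bilinear] and m2 = bilinear_mapsD(2)[OF R.mult_bilinear]
  let ?\<gamma> = "\<lambda>x y z. g x \<otimes>\<^bsub>R\<^esub> (h y \<otimes>\<^bsub>R\<^esub> l z)"
  have "sweedler k C R (\<lambda>x z. (g \<otimes>\<^bsub>?E\<^esub> h) x \<otimes>\<^bsub>R\<^esub> l z) c
      = sweedler k C R (\<lambda>x z. g x \<otimes>\<^bsub>R\<^esub> (h \<otimes>\<^bsub>?E\<^esub> l) z) c" if c: "c \<in> carrier C" for c
  proof -
    have lin: "(\<lambda>x. ?\<gamma> x y z) \<in> linear_maps k C R" "(\<lambda>y. ?\<gamma> x y z) \<in> linear_maps k C R"
      "?\<gamma> x y \<in> linear_maps k C R" if "x \<in> carrier C" "y \<in> carrier C" "z \<in> carrier C" for x y z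
      using linear_maps_compose[OF assms(1) m2[of "h y \<otimes>\<^bsub>R\<^esub> l z"]]
        linear_maps_compose[OF linear_maps_compose[OF assms(2) m2[of "l z"]] m1[of "g x"]]
        linear_maps_compose[OF linear_maps_compose[OF assms(3) m1[of "h y"]] m1[of "g x"]]
        that g h l by auto
    have "sweedler k C R (\<lambda>x z. (g \<otimes>\<^bsub>?E\<^esub> h) x \<otimes>\<^bsub>R\<^esub> l z) c
        = sweedler k C R (\<lambda>x z. sweedler k C R (\<lambda>u v. ?\<gamma> u v z) x) c"
    proof (rule sweedler_cong[OF R_module c])
      fix x z assume x: "x \<in> carrier C" and z: "z \<in> carrier C"
      have "(g \<otimes>\<^bsub>?E\<^esub> h) x \<otimes>\<^bsub>R\<^esub> l z = sweedler k C R (\<lambda>x y. g x \<otimes>\<^bsub>R\<^esub> h y \<otimes>\<^bsub>R\<^esub> l z) x"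
        using x sweedler_compose[OF R_module R_module product_bilinear[OF assms(1,2)] m2[OF l[OF z]] x]
        by (simp add: conv_algebra_simps)
      also have "\<dots> = sweedler k C R (\<lambda>u v. ?\<gamma> u v z) x"
        by (rule sweedler_cong[OF R_module x]) (simp_all add: g h l z R.m_assoc)
      finally show eq: "(g \<otimes>\<^bsub>?E\<^esub> h) x \<otimes>\<^bsub>R\<^esub> l z = sweedler k C R (\<lambda>u v. ?\<gamma> u v z) x" .
      have "(\<lambda>u v. ?\<gamma> u v z) \<in> bilinear_maps k C C R"
        by (rule bilinear_mapsI) (use lin z in auto)
      from linear_mapsD(1)[OF sweedler_linear[OF R_module this] x]
      show "sweedler k C R (\<lambda>u v. ?\<gamma> u v z) x \<in> carrier R" .
    qed
    also have "\<dots> = sweedler k C R (\<lambda>x y. sweedler k C R (?\<gamma> x) y) c"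
      by (rule sweedler_coassociative[OF R_module c]) (use lin in auto)
    also have "\<dots> = sweedler k C R (\<lambda>x z. g x \<otimes>\<^bsub>R\<^esub> (h \<otimes>\<^bsub>?E\<^esub> l) z) c"
    proof (rule sweedler_cong[OF R_module c])
      fix x y assume x: "x \<in> carrier C" and y: "y \<in> carrier C"
      show "sweedler k C R (?\<gamma> x) y = g x \<otimes>\<^bsub>R\<^esub> (h \<otimes>\<^bsub>?E\<^esub> l) y"
        using y sweedler_compose[OF R_module R_module product_bilinear[OF assms(2,3)] m1[OF g[OF x]] y]
        by (simp add: conv_algebra_simps)
      have "(h \<otimes>\<^bsub>?E\<^esub> l) y \<in> carrier R"
        using linear_mapsD(1)[of _ k C R, OF IntD1] conv_algebra_mult_closed[OF assms(2,3)] y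
        unfolding conv_algebra_simps(1) by blast
      then show "g x \<otimes>\<^bsub>R\<^esub> (h \<otimes>\<^bsub>?E\<^esub> l) y \<in> carrier R" using g[OF x] by simp
    qed
    finally show ?thesis .
  qed
  then show ?thesis
    unfolding conv_algebra_simps(2)[where g = "g \<otimes>\<^bsub>?E\<^esub> h"] conv_algebra_simps(2)[where h = "h \<otimes>\<^bsub>?E\<^esub> l"]
    by (intro restrict_ext)
qed

lemma conv_algebra_unit:
  assumes "g \<in> linear_maps k C R" "c \<in> carrier C"
  shows "(\<one>\<^bsub>conv_algebra k C R\<^esub> \<otimes>\<^bsub>conv_algebra k C R\<^esub> g) c = g c"
    and "(g \<otimes>\<^bsub>conv_algebra k C R\<^esub> \<one>\<^bsub>conv_algebra k C R\<^esub>) c = g c"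
proof -
  note g = linear_mapsD(1)[OF assms(1)]
  have "sweedler k C R (\<lambda>x y. \<one>\<^bsub>conv_algebra k C R\<^esub> x \<otimes>\<^bsub>R\<^esub> g y) c
      = sweedler k C R (\<lambda>x y. counit C x \<odot>\<^bsub>R\<^esub> g y) c"
    by (rule sweedler_cong[OF R_module assms(2)])
      (simp_all add: conv_algebra_simps g counit_closed R.smult_mult_left)
  then show "(\<one>\<^bsub>conv_algebra k C R\<^esub> \<otimes>\<^bsub>conv_algebra k C R\<^esub> g) c = g c"
    using sweedler_counit[OF R_module assms] assms(2) by (simp add: conv_algebra_simps(2))
  have "sweedler k C R (\<lambda>x y. g x \<otimes>\<^bsub>R\<^esub> \<one>\<^bsub>conv_algebra k C R\<^esub> y) c
      = sweedler k C R (\<lambda>x y. counit C y \<odot>\<^bsub>R\<^esub> g x) c"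
    by (rule sweedler_cong[OF R_module assms(2)])
      (simp_all add: conv_algebra_simps g counit_closed R.smult_mult_right)
  then show "(g \<otimes>\<^bsub>conv_algebra k C R\<^esub> \<one>\<^bsub>conv_algebra k C R\<^esub>) c = g c"
    using sweedler_counit[OF R_module assms] assms(2) by (simp add: conv_algebra_simps(2))
qed

theorem conv_algebra_unital_algebra: "unital_algebra k (conv_algebra k C R)"
proof -
  let ?E = "conv_algebra k C R"
  interpret E: module k ?E by (rule conv_algebra_module)
  have lin: "g \<in> linear_maps k C R" if "g \<in> carrier ?E" for g
    using that by (simp add: conv_algebra_simps)
  have one: "\<one>\<^bsub>?E\<^esub> \<in> carrier ?E"
    using counit_multiple_linear[OF R_module R.one_closed]
    by (simp add: conv_algebra_simps restrict_linear[OF C_module])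
  have closed: "g \<otimes>\<^bsub>?E\<^esub> h \<in> carrier ?E" if "g \<in> carrier ?E" "h \<in> carrier ?E" for g h
    using conv_algebra_mult_closed that lin by blast
  have ext: "g = h" if "g \<in> carrier ?E" "h \<in> carrier ?E" "\<And>c. c \<in> carrier C \<Longrightarrow> g c = h c" for g h
    using that by (auto simp: conv_algebra_simps(1) intro: extensionalityI)
  have "monoid ?E"
  proof (rule monoidI)
    fix g assume g: "g \<in> carrier ?E"
    show "\<one>\<^bsub>?E\<^esub> \<otimes>\<^bsub>?E\<^esub> g = g"
      by (rule ext[OF closed[OF one g] g conv_algebra_unit(1)[OF lin[OF g]]])
    show "g \<otimes>\<^bsub>?E\<^esub> \<one>\<^bsub>?E\<^esub> = g"
      by (rule ext[OF closed[OF g one] g conv_algebra_unit(2)[OF lin[OF g]]])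
  qed (use closed one lin conv_algebra_mult_assoc in auto)
  note l = linear_mapsD[OF bilinear_mapsD(1)[OF conv_algebra_mult_bilinear]]
  note r = linear_mapsD[OF bilinear_mapsD(2)[OF conv_algebra_mult_bilinear]]
  have "ring ?E"
    by (rule ringI[OF E.M.abelian_group_axioms \<open>monoid ?E\<close>]) (simp_all add: l(2) r(2))
  then show ?thesis
    by (intro unital_algebra.intro unital_algebra_axioms.intro field_axioms E.module_axioms)
      (simp_all add: l(3) r(3))
qed

end

text \<open>An algebra map \<open>F\<close> out of a Hopf algebra has the convolution inverse \<open>F \<circ> S\<close>, because
  \<open>F(b\<^sub>1) F(S b\<^sub>2) = F(b\<^sub>1 S(b\<^sub>2)) = \<epsilon>(b)\<close>.\<close>

lemma hopf_algebra_map_unit: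
  assumes "hopf_algebra k B" "unital_algebra k R"
    and F: "F \<in> linear_maps k B R"
    and mult: "\<And>x y. \<lbrakk>x \<in> carrier B; y \<in> carrier B\<rbrakk> \<Longrightarrow> F (x \<otimes>\<^bsub>B\<^esub> y) = F x \<otimes>\<^bsub>R\<^esub> F y"
    and one: "F \<one>\<^bsub>B\<^esub> = \<one>\<^bsub>R\<^esub>"
  shows "restrict F (carrier B) \<in> Units (conv_algebra k B R)"
proof -
  interpret B: hopf_algebra k B by fact
  interpret R: unital_algebra k R by fact
  interpret convolution k B R ..
  let ?E = "conv_algebra k B R"
  obtain S where S: "antipode k B S" using B.has_antipode by blast
  then have Sl: "S \<in> linear_maps k B B" by (simp add: antipode_def)
  note FS = linear_maps_compose[OF Sl F]
  let ?f = "restrict F (carrier B)" and ?g = "restrict (\<lambda>b. F (S b)) (carrier B)"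
  note Fc = linear_mapsD(1)[OF F] and Sc = linear_mapsD(1)[OF Sl]
  have val: "F (counit B b \<odot>\<^bsub>B\<^esub> \<one>\<^bsub>B\<^esub>) = counit B b \<odot>\<^bsub>R\<^esub> \<one>\<^bsub>R\<^esub>" if "b \<in> carrier B" for b
    using linear_mapsD(3)[OF F] that by (simp add: B.counit_closed one)
  have b1: "(\<lambda>x y. S x \<otimes>\<^bsub>B\<^esub> y) \<in> bilinear_maps k B B B"
    using bilinear_maps_compose[OF B.mult_bilinear Sl linear_maps_id linear_maps_id] .
  have b2: "(\<lambda>x y. x \<otimes>\<^bsub>B\<^esub> S y) \<in> bilinear_maps k B B B"
    using bilinear_maps_compose[OF B.mult_bilinear linear_maps_id Sl linear_maps_id] .
  have "?g \<otimes>\<^bsub>?E\<^esub> ?f = \<one>\<^bsub>?E\<^esub>"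
    unfolding conv_algebra_simps
  proof (rule restrict_ext)
    fix b assume b: "b \<in> carrier B"
    have "sweedler k B R (\<lambda>x y. ?g x \<otimes>\<^bsub>R\<^esub> ?f y) b = sweedler k B R (\<lambda>x y. F (S x \<otimes>\<^bsub>B\<^esub> y)) b"
      by (rule B.sweedler_cong[OF R_module b]) (simp_all add: Fc Sc mult)
    also have "\<dots> = counit B b \<odot>\<^bsub>R\<^esub> \<one>\<^bsub>R\<^esub>"
      using B.sweedler_compose[OF B.C_module R_module b1 F b] S b val[OF b]
      by (simp add: antipode_def)
    finally show "sweedler k B R (\<lambda>x y. ?g x \<otimes>\<^bsub>R\<^esub> ?f y) b = counit B b \<odot>\<^bsub>R\<^esub> \<one>\<^bsub>R\<^esub>" .
  qed
  moreover have "?f \<otimes>\<^bsub>?E\<^esub> ?g = \<one>\<^bsub>?E\<^esub>"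
    unfolding conv_algebra_simps
  proof (rule restrict_ext)
    fix b assume b: "b \<in> carrier B"
    have "sweedler k B R (\<lambda>x y. ?f x \<otimes>\<^bsub>R\<^esub> ?g y) b = sweedler k B R (\<lambda>x y. F (x \<otimes>\<^bsub>B\<^esub> S y)) b"
      by (rule B.sweedler_cong[OF R_module b]) (simp_all add: Fc Sc mult)
    also have "\<dots> = counit B b \<odot>\<^bsub>R\<^esub> \<one>\<^bsub>R\<^esub>"
      using B.sweedler_compose[OF B.C_module R_module b2 F b] S b val[OF b]
      by (simp add: antipode_def)
    finally show "sweedler k B R (\<lambda>x y. ?f x \<otimes>\<^bsub>R\<^esub> ?g y) b = counit B b \<odot>\<^bsub>R\<^esub> \<one>\<^bsub>R\<^esub>" .
  qed
  moreover have "?f \<in> carrier ?E" "?g \<in> carrier ?E"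
    using F FS by (simp_all add: conv_algebra_simps restrict_linear[OF B.C_module])
  ultimately show ?thesis unfolding Units_def by blast
qed

section \<open>Regular elements of finite dimensional algebras\<close>

text \<open>Gaussian elimination, one equation and one unknown at a time.\<close>

lemma (in field) homogeneous_system:
  assumes "finite I" "finite J" "card I < card J"
    and "\<And>i j. \<lbrakk>i \<in> I; j \<in> J\<rbrakk> \<Longrightarrow> x i j \<in> carrier R"
  shows "\<exists>c. (\<forall>j\<in>J. c j \<in> carrier R) \<and> (\<exists>j\<in>J. c j \<noteq> \<zero>) \<and>
    (\<forall>i\<in>I. (\<Oplus>j\<in>J. c j \<otimes> x i j) = \<zero>)"
  using assms
proof (induction I arbitrary: J x)
  case empty
  then have "J \<noteq> {}" by auto
  then show ?case by (intro exI[of _ "\<lambda>_. \<one>"]) auto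
next
  case (insert e I)
  note x = insert.prems(3)
  show ?case
  proof (cases "\<forall>j\<in>J. x e j = \<zero>")
    case True
    have "card I < card J" using insert.prems(2) insert.hyps by simp
    then obtain c where c: "\<forall>j\<in>J. c j \<in> carrier R" "\<exists>j\<in>J. c j \<noteq> \<zero>"
      "\<forall>i\<in>I. (\<Oplus>j\<in>J. c j \<otimes> x i j) = \<zero>"
      using insert.IH[OF insert.prems(1), of x] x by blast
    have "(\<Oplus>j\<in>J. c j \<otimes> x e j) = (\<Oplus>j\<in>J. \<zero>)"
      by (rule finsum_cong') (use c(1) True in auto)
    then show ?thesis using c by (intro exI[of _ c]) (auto simp: finsum_zero)
  next
    case False
    then obtain p where p: "p \<in> J" "x e p \<noteq> \<zero>" by blast
    let ?J = "J - {p}"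
    \<comment> \<open>Equation \<open>e\<close> is used, with pivot \<open>x e p\<close>, to eliminate the unknown \<open>p\<close> from the others.\<close>
    define r where "r = inv (x e p)"
    have xp: "x e p \<in> carrier R" using x p by blast
    then have r: "r \<in> carrier R" "r \<otimes> x e p = \<one>"
      unfolding r_def using p(2) by (auto simp: field_Units)
    have J: "finite ?J" "insert p ?J = J" "p \<notin> ?J" using insert.prems(1) p by auto
    have card: "card I < card ?J" using insert.prems(1,2) insert.hyps p by simp
    define y where "y i j = x i j \<ominus> (x i p \<otimes> r) \<otimes> x e j" for i j
    have y: "y i j \<in> carrier R" if "i \<in> I" "j \<in> ?J" for i j
      using that x p r unfolding y_def by auto
    obtain c where c: "\<forall>j\<in>?J. c j \<in> carrier R" "\<exists>j\<in>?J. c j \<noteq> \<zero>"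
      "\<forall>i\<in>I. (\<Oplus>j\<in>?J. c j \<otimes> y i j) = \<zero>"
      using insert.IH[OF J(1) card, of y] y by blast
    define s where "s i = (\<Oplus>j\<in>?J. c j \<otimes> x i j)" for i
    have s: "s i \<in> carrier R" if "i \<in> insert e I" for i
      unfolding s_def using that c(1) x by (intro finsum_closed) auto
    \<comment> \<open>The value at \<open>p\<close> is the one that equation \<open>e\<close> forces.\<close>
    define d where "d = c(p := \<ominus> (r \<otimes> s e))"
    have d: "d j \<in> carrier R" if "j \<in> J" for j
      using that c(1) r s unfolding d_def by auto
    have sum_d: "(\<Oplus>j\<in>J. d j \<otimes> x i j) = \<ominus> (r \<otimes> s e) \<otimes> x i p \<oplus> s i" if i: "i \<in> insert e I" for i
    proof -
      have "(\<Oplus>j\<in>insert p ?J. d j \<otimes> x i j) = d p \<otimes> x i p \<oplus> (\<Oplus>j\<in>?J. d j \<otimes> x i j)"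
        by (rule finsum_insert[OF J(1,3)]) (use d p x i in auto)
      also have "(\<Oplus>j\<in>?J. d j \<otimes> x i j) = s i"
        unfolding s_def by (rule finsum_cong') (use c(1) x i in \<open>auto simp: d_def\<close>)
      finally show ?thesis using J(2) by (simp add: d_def)
    qed
    have zero: "(\<Oplus>j\<in>J. d j \<otimes> x i j) = \<zero>" if i: "i \<in> insert e I" for i
    proof (cases "i = e")
      case True
      have "\<ominus> (r \<otimes> s e) \<otimes> x e p = \<ominus> ((r \<otimes> x e p) \<otimes> s e)"
        using r(1) s[of e] xp by (simp add: l_minus r_minus m_ac)
      also have "\<dots> = \<ominus> s e" using s[of e] r(2) by simp
      finally have "(\<Oplus>j\<in>J. d j \<otimes> x e j) = \<ominus> s e \<oplus> s e" using sum_d[of e] by simp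
      also have "\<dots> = \<zero>" using s[of e] by (intro l_neg) simp
      finally show ?thesis using True by blast
    next
      case False
      then have i': "i \<in> I" using i by simp
      have ip: "x i p \<in> carrier R" using x i p by blast
      have "(\<Oplus>j\<in>?J. c j \<otimes> x i j)
          = (\<Oplus>j\<in>?J. c j \<otimes> y i j \<oplus> (x i p \<otimes> r) \<otimes> (c j \<otimes> x e j))"
      proof (rule finsum_cong'[OF refl])
        fix j assume j: "j \<in> ?J"
        have m: "c j \<in> carrier R" "x i j \<in> carrier R" "x e j \<in> carrier R"
          using j c(1) x i by auto
        have "c j \<otimes> y i j \<oplus> (x i p \<otimes> r) \<otimes> (c j \<otimes> x e j)
            = c j \<otimes> (y i j \<oplus> (x i p \<otimes> r) \<otimes> x e j)"
          using m ip r y[OF i' j] by (simp add: r_distr m_ac)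
        also have "y i j \<oplus> (x i p \<otimes> r) \<otimes> x e j = x i j"
          using m ip r unfolding y_def by (simp add: a_minus_def a_assoc l_neg)
        finally show "c j \<otimes> x i j = c j \<otimes> y i j \<oplus> (x i p \<otimes> r) \<otimes> (c j \<otimes> x e j)" ..
      qed (use c(1) y[OF i'] ip r x in auto)
      also have "\<dots> = (\<Oplus>j\<in>?J. c j \<otimes> y i j) \<oplus> (\<Oplus>j\<in>?J. (x i p \<otimes> r) \<otimes> (c j \<otimes> x e j))"
        by (rule finsum_addf) (use c(1) y[OF i'] ip r x in auto)
      also have "\<dots> = (x i p \<otimes> r) \<otimes> s e"
        unfolding s_def using c i' ip r x s[of e]
        by (subst finsum_rdistr[OF J(1)]) (auto simp flip: s_def intro!: finsum_closed)
      finally have "s i = x i p \<otimes> r \<otimes> s e" unfolding s_def .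
      then show ?thesis
        using sum_d[OF i] s[of e] ip r(1) by (simp add: l_minus r_minus m_ac l_neg)
    qed
    have "\<exists>j\<in>J. d j \<noteq> \<zero>" using c(2) J unfolding d_def by fastforce
    then show ?thesis using d zero by (intro exI[of _ d]) auto
  qed
qed

text \<open>If \<open>x\<close> is a left regular root of a nonzero polynomial, then cancelling a power of \<open>x\<close>
  makes the constant term nonzero, and solving for that term inverts \<open>x\<close>. The inverse is a
  polynomial in \<open>x\<close>, hence two-sided.\<close>

lemma (in unital_algebra) regular_algebraic_unit:
  fixes n :: nat
  assumes x: "x \<in> carrier A"
    and regular: "\<And>y. \<lbrakk>y \<in> carrier A; x \<otimes>\<^bsub>A\<^esub> y = \<zero>\<^bsub>A\<^esub>\<rbrakk> \<Longrightarrow> y = \<zero>\<^bsub>A\<^esub>"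
    and "\<And>i. i \<le> n \<Longrightarrow> c i \<in> carrier k" "\<exists>i\<le>n. c i \<noteq> \<zero>\<^bsub>k\<^esub>"
    and "(\<Oplus>\<^bsub>A\<^esub>i\<in>{..n}. c i \<odot>\<^bsub>A\<^esub> (x [^]\<^bsub>A\<^esub> i)) = \<zero>\<^bsub>A\<^esub>"
  shows "x \<in> Units A"
  using assms(3-)
proof (induction n arbitrary: c)
  case 0
  then have c: "c 0 \<in> carrier k" "c 0 \<noteq> \<zero>\<^bsub>k\<^esub>" and "c 0 \<odot>\<^bsub>A\<^esub> \<one>\<^bsub>A\<^esub> = \<zero>\<^bsub>A\<^esub>"
    by auto
  then have "inv\<^bsub>k\<^esub> (c 0) \<odot>\<^bsub>A\<^esub> (c 0 \<odot>\<^bsub>A\<^esub> \<one>\<^bsub>A\<^esub>) = \<zero>\<^bsub>A\<^esub>"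
    by (simp add: field_Units)
  then have "\<one>\<^bsub>A\<^esub> = \<zero>\<^bsub>A\<^esub>" using c by (simp add: field_Units flip: smult_assoc1)
  then have "\<zero>\<^bsub>A\<^esub> \<otimes>\<^bsub>A\<^esub> x = \<one>\<^bsub>A\<^esub>" "x \<otimes>\<^bsub>A\<^esub> \<zero>\<^bsub>A\<^esub> = \<one>\<^bsub>A\<^esub>" using x by simp_all
  then show ?case
    using x M.zero_closed unfolding Units_def by blast
next
  case (Suc n)
  note c = Suc.prems(1)
  have pow: "x [^]\<^bsub>A\<^esub> i \<in> carrier A" for i :: nat using x by simp
  \<comment> \<open>Splitting off the constant term, the relation reads \<open>x q + c 0 = 0\<close>.\<close>
  define q where "q = (\<Oplus>\<^bsub>A\<^esub>i\<in>{..n}. c (Suc i) \<odot>\<^bsub>A\<^esub> (x [^]\<^bsub>A\<^esub> i))"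
  have q: "q \<in> carrier A" unfolding q_def using c pow by (intro finsum_closed) auto
  have A: "monoid A" "semiring A" by unfold_locales
  have comm: "x \<otimes>\<^bsub>A\<^esub> (x [^]\<^bsub>A\<^esub> i) = x [^]\<^bsub>A\<^esub> Suc i" for i :: nat
    by (rule monoid.nat_pow_Suc2[OF A(1) x, symmetric])
  have term_closed: "c (Suc i) \<odot>\<^bsub>A\<^esub> (x [^]\<^bsub>A\<^esub> j) \<in> carrier A" if "i \<in> {..n}" for i and j :: nat
    using that c pow by auto
  have "x \<otimes>\<^bsub>A\<^esub> q = (\<Oplus>\<^bsub>A\<^esub>i\<in>{..n}. x \<otimes>\<^bsub>A\<^esub> (c (Suc i) \<odot>\<^bsub>A\<^esub> (x [^]\<^bsub>A\<^esub> i)))"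
    unfolding q_def by (rule semiring.finsum_rdistr[OF A(2)]) (use x term_closed in auto)
  also have "\<dots> = (\<Oplus>\<^bsub>A\<^esub>i\<in>{..n}. c (Suc i) \<odot>\<^bsub>A\<^esub> (x [^]\<^bsub>A\<^esub> Suc i))"
  proof (rule finsum_cong'[OF refl])
    fix i assume "i \<in> {..n}"
    then show "x \<otimes>\<^bsub>A\<^esub> (c (Suc i) \<odot>\<^bsub>A\<^esub> (x [^]\<^bsub>A\<^esub> i)) = c (Suc i) \<odot>\<^bsub>A\<^esub> (x [^]\<^bsub>A\<^esub> Suc i)"
      using smult_mult_right[of "c (Suc i)" x "x [^]\<^bsub>A\<^esub> i"] c x pow comm by simp
  qed (use term_closed in blast)
  finally have xq: "x \<otimes>\<^bsub>A\<^esub> q = (\<Oplus>\<^bsub>A\<^esub>i\<in>{..n}. c (Suc i) \<odot>\<^bsub>A\<^esub> (x [^]\<^bsub>A\<^esub> Suc i))" .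
  have "q \<otimes>\<^bsub>A\<^esub> x = (\<Oplus>\<^bsub>A\<^esub>i\<in>{..n}. (c (Suc i) \<odot>\<^bsub>A\<^esub> (x [^]\<^bsub>A\<^esub> i)) \<otimes>\<^bsub>A\<^esub> x)"
    unfolding q_def by (rule semiring.finsum_ldistr[OF A(2)]) (use x term_closed in auto)
  also have "\<dots> = (\<Oplus>\<^bsub>A\<^esub>i\<in>{..n}. c (Suc i) \<odot>\<^bsub>A\<^esub> (x [^]\<^bsub>A\<^esub> Suc i))"
  proof (rule finsum_cong'[OF refl])
    fix i assume "i \<in> {..n}"
    then show "(c (Suc i) \<odot>\<^bsub>A\<^esub> (x [^]\<^bsub>A\<^esub> i)) \<otimes>\<^bsub>A\<^esub> x = c (Suc i) \<odot>\<^bsub>A\<^esub> (x [^]\<^bsub>A\<^esub> Suc i)"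
      using smult_mult_left[of "c (Suc i)" "x [^]\<^bsub>A\<^esub> i" x] c x pow by simp
  qed (use term_closed in blast)
  finally have qx: "q \<otimes>\<^bsub>A\<^esub> x = x \<otimes>\<^bsub>A\<^esub> q" using xq by simp
  have "(\<Oplus>\<^bsub>A\<^esub>i\<in>{..Suc n}. c i \<odot>\<^bsub>A\<^esub> (x [^]\<^bsub>A\<^esub> i))
      = (\<Oplus>\<^bsub>A\<^esub>i\<in>{..n}. c (Suc i) \<odot>\<^bsub>A\<^esub> (x [^]\<^bsub>A\<^esub> Suc i)) \<oplus>\<^bsub>A\<^esub> c 0 \<odot>\<^bsub>A\<^esub> (x [^]\<^bsub>A\<^esub> (0 :: nat))"
    by (rule finsum_Suc2) (use c pow in auto)
  then have rel: "x \<otimes>\<^bsub>A\<^esub> q \<oplus>\<^bsub>A\<^esub> c 0 \<odot>\<^bsub>A\<^esub> \<one>\<^bsub>A\<^esub> = \<zero>\<^bsub>A\<^esub>"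
    using Suc.prems(3) xq by simp
  show ?case
  proof (cases "c 0 = \<zero>\<^bsub>k\<^esub>")
    case True
    then have "q = \<zero>\<^bsub>A\<^esub>" using rel q x regular by simp
    moreover have "\<exists>i\<le>n. c (Suc i) \<noteq> \<zero>\<^bsub>k\<^esub>"
      using Suc.prems(2) True by (metis Suc_le_mono not0_implies_Suc)
    ultimately show ?thesis
      using Suc.IH[of "\<lambda>i. c (Suc i)"] c unfolding q_def by simp
  next
    case False
    define a where "a = inv\<^bsub>k\<^esub> (c 0)"
    have a: "a \<in> carrier k" "a \<otimes>\<^bsub>k\<^esub> c 0 = \<one>\<^bsub>k\<^esub>"
      unfolding a_def using c[of 0] False by (auto simp: field_Units)
    have c0: "c 0 \<odot>\<^bsub>A\<^esub> \<one>\<^bsub>A\<^esub> \<in> carrier A" using c[of 0] by simp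
    have "x \<otimes>\<^bsub>A\<^esub> q = \<ominus>\<^bsub>A\<^esub> (c 0 \<odot>\<^bsub>A\<^esub> \<one>\<^bsub>A\<^esub>)"
      using M.minus_equality[OF rel c0] x q by simp
    then have "(\<ominus>\<^bsub>k\<^esub> a) \<odot>\<^bsub>A\<^esub> (x \<otimes>\<^bsub>A\<^esub> q) = a \<odot>\<^bsub>A\<^esub> (c 0 \<odot>\<^bsub>A\<^esub> \<one>\<^bsub>A\<^esub>)"
      using a c0 by (simp add: smult_l_minus smult_r_minus)
    also have "\<dots> = \<one>\<^bsub>A\<^esub>" using a c[of 0] by (simp flip: smult_assoc1)
    finally have one: "(\<ominus>\<^bsub>k\<^esub> a) \<odot>\<^bsub>A\<^esub> (x \<otimes>\<^bsub>A\<^esub> q) = \<one>\<^bsub>A\<^esub>" .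
    have "x \<otimes>\<^bsub>A\<^esub> ((\<ominus>\<^bsub>k\<^esub> a) \<odot>\<^bsub>A\<^esub> q) = \<one>\<^bsub>A\<^esub>" "((\<ominus>\<^bsub>k\<^esub> a) \<odot>\<^bsub>A\<^esub> q) \<otimes>\<^bsub>A\<^esub> x = \<one>\<^bsub>A\<^esub>"
      using one smult_mult_right[of "\<ominus>\<^bsub>k\<^esub> a" x q] smult_mult_left[of "\<ominus>\<^bsub>k\<^esub> a" q x] qx a(1) x q
      by simp_all
    then show ?thesis
      using x q a(1) unfolding Units_def by blast
  qed
qed

lemma linear_maps_image_submodule:
  assumes "module k V" "module k W" "h \<in> linear_maps k V W"
  shows "submodule (h ` carrier V) k W"
proof -
  interpret V: module k V by fact
  interpret W: module k W by fact
  note h = linear_mapsD[OF assms(3)]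
  show ?thesis
  proof (rule W.submoduleI)
    show "\<zero>\<^bsub>W\<^esub> \<in> h ` carrier V"
      using linear_maps_zero[OF assms] V.M.zero_closed by (rule image_eqI[OF sym])
    fix w assume "w \<in> h ` carrier V"
    then obtain v where v: "v \<in> carrier V" "w = h v" by blast
    show "\<ominus>\<^bsub>W\<^esub> w \<in> h ` carrier V"
      using linear_maps_minus[OF assms v(1)] V.M.a_inv_closed[OF v(1)] unfolding v(2)
      by (rule image_eqI[OF sym])
    show "a \<odot>\<^bsub>W\<^esub> w \<in> h ` carrier V" if a: "a \<in> carrier k" for a
      using h(3)[OF a v(1)] V.smult_closed[OF a v(1)] unfolding v(2) by (rule image_eqI[OF sym])
    fix w' assume "w' \<in> h ` carrier V"
    then obtain v' where v': "v' \<in> carrier V" "w' = h v'" by blast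
    show "w \<oplus>\<^bsub>W\<^esub> w' \<in> h ` carrier V"
      using h(2)[OF v(1) v'(1)] V.M.a_closed[OF v(1) v'(1)] unfolding v(2) v'(2)
      by (rule image_eqI[OF sym])
  qed (use h in auto)
qed

lemma free_lift_span:
  assumes "module k V" "S \<subseteq> carrier V" "linear_span k V S = carrier V"
  shows "free_lift k V (\<lambda>s. s) ` carrier (free_module k S) = carrier V"
proof -
  interpret V: module k V by fact
  have g: "(\<lambda>s. s) \<in> S \<rightarrow> carrier V" using assms(2) by auto
  note L = free_lift_linear[OF assms(1) g]
  have "S \<subseteq> free_lift k V (\<lambda>s. s) ` carrier (free_module k S)"
  proof
    fix s assume s: "s \<in> S"
    show "s \<in> free_lift k V (\<lambda>s. s) ` carrier (free_module k S)"
      using free_lift_free_gen[OF assms(1) g s] free_gen_closed[OF V.R.cring_axioms s]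
      by (metis imageI)
  qed
  then have "linear_span k V S \<subseteq> free_lift k V (\<lambda>s. s) ` carrier (free_module k S)"
    by (rule linear_span_minimal[OF linear_maps_image_submodule[OF
            free_module_is_module[OF V.R.cring_axioms] assms(1) L]])
  then show ?thesis using assms(3) linear_mapsD(1)[OF L] by auto
qed

lemma free_module_finsum_coordinate:
  assumes "cring k" "finite I" "f \<in> I \<rightarrow> carrier (free_module k T)"
  shows "(\<Oplus>\<^bsub>free_module k T\<^esub>i\<in>I. f i) t = (\<Oplus>\<^bsub>k\<^esub>i\<in>I. f i t)"
proof -
  interpret k: cring k by fact
  interpret F: module k "free_module k T" by (rule free_module_is_module[OF assms(1)])
  show ?thesis
    using assms(2,3)
  proof (induction I)
    case empty
    have "\<zero>\<^bsub>free_module k T\<^esub> t = \<zero>\<^bsub>k\<^esub>" by (simp add: free_module_def)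
    then show ?case by simp
  next
    case (insert i I)
    have car: "u t \<in> carrier k" if "u \<in> carrier (free_module k T)" for u
      using that unfolding free_module_def by (cases "t \<in> T") auto
    have "(\<lambda>i. f i t) \<in> insert i I \<rightarrow> carrier k" using car insert.prems by blast
    moreover have "(u \<oplus>\<^bsub>free_module k T\<^esub> v) t = u t \<oplus>\<^bsub>k\<^esub> v t" for u v
      by (simp add: free_module_def)
    ultimately show ?case using insert by (simp add: Pi_iff)
  qed
qed

lemma linear_maps_combination:
  assumes "module k W" "finite I" "\<And>i. i \<in> I \<Longrightarrow> c i \<in> carrier k"
    and "\<And>i. i \<in> I \<Longrightarrow> p i \<in> linear_maps k V W"
  shows "(\<lambda>v. \<Oplus>\<^bsub>W\<^esub>i\<in>I. c i \<odot>\<^bsub>W\<^esub> p i v) \<in> linear_maps k V W"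
proof -
  interpret W: module k W by fact
  have summand: "c i \<odot>\<^bsub>W\<^esub> p i v \<in> carrier W" if "i \<in> I" "v \<in> carrier V" for i v
    using that assms(3) linear_mapsD(1)[OF assms(4)] by blast
  show ?thesis
  proof (rule linear_mapsI)
    fix v assume v: "v \<in> carrier V"
    show "(\<Oplus>\<^bsub>W\<^esub>i\<in>I. c i \<odot>\<^bsub>W\<^esub> p i v) \<in> carrier W"
      using summand v by (intro W.M.finsum_closed) blast
    fix a assume a: "a \<in> carrier k"
    have "(\<Oplus>\<^bsub>W\<^esub>i\<in>I. c i \<odot>\<^bsub>W\<^esub> p i (a \<odot>\<^bsub>V\<^esub> v)) = (\<Oplus>\<^bsub>W\<^esub>i\<in>I. a \<odot>\<^bsub>W\<^esub> (c i \<odot>\<^bsub>W\<^esub> p i v))"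
    proof (rule W.M.finsum_cong'[OF refl])
      fix i assume i: "i \<in> I"
      show "c i \<odot>\<^bsub>W\<^esub> p i (a \<odot>\<^bsub>V\<^esub> v) = a \<odot>\<^bsub>W\<^esub> (c i \<odot>\<^bsub>W\<^esub> p i v)"
        using linear_mapsD(1,3)[OF assms(4)[OF i]] assms(3)[OF i] a v
        by (simp add: W.R.m_comm flip: W.smult_assoc1)
    qed (use summand v a in blast)
    also have "\<dots> = a \<odot>\<^bsub>W\<^esub> (\<Oplus>\<^bsub>W\<^esub>i\<in>I. c i \<odot>\<^bsub>W\<^esub> p i v)"
      by (rule W.finsum_smult_ldistr[symmetric]) (use assms(2) a summand v in blast)+
    finally show "(\<Oplus>\<^bsub>W\<^esub>i\<in>I. c i \<odot>\<^bsub>W\<^esub> p i (a \<odot>\<^bsub>V\<^esub> v)) = a \<odot>\<^bsub>W\<^esub> (\<Oplus>\<^bsub>W\<^esub>i\<in>I. c i \<odot>\<^bsub>W\<^esub> p i v)" .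
  next
    fix v w assume v: "v \<in> carrier V" and w: "w \<in> carrier V"
    have "(\<Oplus>\<^bsub>W\<^esub>i\<in>I. c i \<odot>\<^bsub>W\<^esub> p i (v \<oplus>\<^bsub>V\<^esub> w))
        = (\<Oplus>\<^bsub>W\<^esub>i\<in>I. c i \<odot>\<^bsub>W\<^esub> p i v \<oplus>\<^bsub>W\<^esub> c i \<odot>\<^bsub>W\<^esub> p i w)"
    proof (rule W.M.finsum_cong'[OF refl])
      fix i assume i: "i \<in> I"
      show "c i \<odot>\<^bsub>W\<^esub> p i (v \<oplus>\<^bsub>V\<^esub> w) = c i \<odot>\<^bsub>W\<^esub> p i v \<oplus>\<^bsub>W\<^esub> c i \<odot>\<^bsub>W\<^esub> p i w"
        using linear_mapsD(1,2)[OF assms(4)[OF i]] assms(3)[OF i] v w by (simp add: W.smult_r_distr)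
    qed (use summand v w in blast)
    also have "\<dots> = (\<Oplus>\<^bsub>W\<^esub>i\<in>I. c i \<odot>\<^bsub>W\<^esub> p i v) \<oplus>\<^bsub>W\<^esub> (\<Oplus>\<^bsub>W\<^esub>i\<in>I. c i \<odot>\<^bsub>W\<^esub> p i w)"
      by (rule W.M.finsum_addf) (use summand v w in blast)+
    finally show "(\<Oplus>\<^bsub>W\<^esub>i\<in>I. c i \<odot>\<^bsub>W\<^esub> p i (v \<oplus>\<^bsub>V\<^esub> w))
        = (\<Oplus>\<^bsub>W\<^esub>i\<in>I. c i \<odot>\<^bsub>W\<^esub> p i v) \<oplus>\<^bsub>W\<^esub> (\<Oplus>\<^bsub>W\<^esub>i\<in>I. c i \<odot>\<^bsub>W\<^esub> p i w)" .
  qed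
qed

text \<open>Between finite dimensional spaces a linear map is given by finitely many matrix entries, and a
  linear relation between maps is a homogeneous system with one equation for each entry.\<close>

lemma linear_maps_dependent:
  assumes k: "field k" and V: "module k V" "finite_dimensional k V"
    and W: "module k W" "finite_dimensional k W"
    and p: "\<And>i :: nat. p i \<in> linear_maps k V W"
  shows "\<exists>n c. (\<forall>i\<le>n. c i \<in> carrier k) \<and> (\<exists>i\<le>n. c i \<noteq> \<zero>\<^bsub>k\<^esub>) \<and>
    (\<forall>v\<in>carrier V. (\<Oplus>\<^bsub>W\<^esub>i\<in>{..n}. c i \<odot>\<^bsub>W\<^esub> p i v) = \<zero>\<^bsub>W\<^esub>)"
proof -
  interpret k: field k by fact
  interpret V: module k V by fact
  interpret W: module k W by fact
  obtain S where S: "finite S" "S \<subseteq> carrier V" "linear_span k V S = carrier V"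
    using V(2) unfolding finite_dimensional_def by blast
  obtain T where T: "finite T" "T \<subseteq> carrier W" "linear_span k W T = carrier W"
    using W(2) unfolding finite_dimensional_def by blast
  let ?F = "free_module k T" and ?L = "free_lift k W (\<lambda>t. t)"
  interpret F: module k ?F by (rule free_module_is_module[OF k.cring_axioms])
  have L: "?L \<in> linear_maps k ?F W"
    by (rule free_lift_linear[OF W(1)]) (use T(2) in auto)
  \<comment> \<open>\<open>u i s\<close> holds coordinates of \<open>p i s\<close> with respect to the spanning set \<open>T\<close>.\<close>
  define u where "u i s = (SOME u. u \<in> carrier ?F \<and> ?L u = p i s)" for i s
  have u: "u i s \<in> carrier ?F" "?L (u i s) = p i s" if "s \<in> S" for i s
  proof -
    have "p i s \<in> ?L ` carrier ?F"
      using free_lift_span[OF W(1) T(2,3)] linear_mapsD(1)[OF p] S(2) that by blast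
    then obtain w where w: "p i s = ?L w" "w \<in> carrier ?F" by (rule imageE)
    have "\<exists>u. u \<in> carrier ?F \<and> ?L u = p i s"
      by (rule exI[of _ w], rule conjI[OF w(2) w(1)[symmetric]])
    from someI_ex[OF this] have "u i s \<in> carrier ?F \<and> ?L (u i s) = p i s"
      unfolding u_def .
    then show "u i s \<in> carrier ?F" "?L (u i s) = p i s" by simp_all
  qed
  let ?n = "card (S \<times> T)"
  have ent: "u i (fst e) (snd e) \<in> carrier k" if "e \<in> S \<times> T" for e i
    using that free_module_support(3)[OF u(1)] by auto
  obtain c where c: "\<And>i. i \<le> ?n \<Longrightarrow> c i \<in> carrier k" "\<exists>i\<le>?n. c i \<noteq> \<zero>\<^bsub>k\<^esub>"
    and eq: "\<And>s t. \<lbrakk>s \<in> S; t \<in> T\<rbrakk> \<Longrightarrow> (\<Oplus>\<^bsub>k\<^esub>i\<in>{..?n}. c i \<otimes>\<^bsub>k\<^esub> u i s t) = \<zero>\<^bsub>k\<^esub>"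
  proof -
    have "\<exists>c. (\<forall>i\<in>{..?n}. c i \<in> carrier k) \<and> (\<exists>i\<in>{..?n}. c i \<noteq> \<zero>\<^bsub>k\<^esub>) \<and>
      (\<forall>e\<in>S \<times> T. (\<Oplus>\<^bsub>k\<^esub>i\<in>{..?n}. c i \<otimes>\<^bsub>k\<^esub> u i (fst e) (snd e)) = \<zero>\<^bsub>k\<^esub>)"
      using S(1) T(1) by (intro k.homogeneous_system) (simp_all add: ent del: card_cartesian_product)
    then obtain c where "\<forall>i\<in>{..?n}. c i \<in> carrier k" "\<exists>i\<in>{..?n}. c i \<noteq> \<zero>\<^bsub>k\<^esub>"
      "\<forall>e\<in>S \<times> T. (\<Oplus>\<^bsub>k\<^esub>i\<in>{..?n}. c i \<otimes>\<^bsub>k\<^esub> u i (fst e) (snd e)) = \<zero>\<^bsub>k\<^esub>"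
      by (elim exE conjE)
    then show thesis by (intro that[of c]) fastforce+
  qed
  let ?P = "\<lambda>v. \<Oplus>\<^bsub>W\<^esub>i\<in>{..?n}. c i \<odot>\<^bsub>W\<^esub> p i v"
  have P: "?P \<in> linear_maps k V W"
    by (rule linear_maps_combination[OF W(1)]) (use c(1) p in auto)
  have "?P s = \<zero>\<^bsub>W\<^esub>" if s: "s \<in> S" for s
  proof -
    have sv: "s \<in> carrier V" using s S(2) by blast
    have cu: "(\<lambda>i. c i \<odot>\<^bsub>?F\<^esub> u i s) \<in> {..?n} \<rightarrow> carrier ?F"
      using c(1) u(1)[OF s] by auto
    have sum0: "(\<Oplus>\<^bsub>?F\<^esub>i\<in>{..?n}. c i \<odot>\<^bsub>?F\<^esub> u i s) = \<zero>\<^bsub>?F\<^esub>"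
    proof
      fix t
      show "(\<Oplus>\<^bsub>?F\<^esub>i\<in>{..?n}. c i \<odot>\<^bsub>?F\<^esub> u i s) t = \<zero>\<^bsub>?F\<^esub> t"
      proof (cases "t \<in> T")
        case True
        have "(\<Oplus>\<^bsub>?F\<^esub>i\<in>{..?n}. c i \<odot>\<^bsub>?F\<^esub> u i s) t = (\<Oplus>\<^bsub>k\<^esub>i\<in>{..?n}. (c i \<odot>\<^bsub>?F\<^esub> u i s) t)"
          by (rule free_module_finsum_coordinate[OF k.cring_axioms _ cu]) simp
        also have "\<dots> = (\<Oplus>\<^bsub>k\<^esub>i\<in>{..?n}. c i \<otimes>\<^bsub>k\<^esub> u i s t)"
          by (simp add: free_module_def)
        finally show ?thesis using eq[OF s True] by (simp add: free_module_def)
      next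
        case False
        then have "w t = \<zero>\<^bsub>k\<^esub>" if "w \<in> carrier ?F" for w
          using that by (simp add: free_module_def)
        from this[OF F.M.finsum_closed[OF cu]] show ?thesis by (simp add: free_module_def)
      qed
    qed
    have "?P s = (\<Oplus>\<^bsub>W\<^esub>i\<in>{..?n}. ?L (c i \<odot>\<^bsub>?F\<^esub> u i s))"
      by (rule W.M.finsum_cong')
        (use c(1) u[OF s] linear_mapsD(3)[OF L] linear_mapsD(1)[OF p sv] in auto)
    also have "\<dots> = ?L (\<Oplus>\<^bsub>?F\<^esub>i\<in>{..?n}. c i \<odot>\<^bsub>?F\<^esub> u i s)"
      by (rule linear_maps_finsum[OF F.module_axioms W(1) L _ cu, symmetric]) simp
    also have "\<dots> = \<zero>\<^bsub>W\<^esub>"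
      using sum0 linear_maps_zero[OF F.module_axioms W(1) L] by simp
    finally show ?thesis .
  qed
  then have "S \<subseteq> {v \<in> carrier V. ?P v = \<zero>\<^bsub>W\<^esub>}" using S(2) by blast
  from linear_span_minimal[OF linear_maps_kernel_submodule[OF V(1) W(1) P] this]
  have "\<forall>v\<in>carrier V. ?P v = \<zero>\<^bsub>W\<^esub>" using S(3) by blast
  then show ?thesis using c by blast
qed

text \<open>Some nontrivial combination of the powers of \<open>x\<close> vanishes, because there are more powers than
  matrix entries.\<close>

lemma (in convolution) regular_conv_unit:
  assumes "finite_dimensional k C" "finite_dimensional k R"
    and x: "x \<in> carrier (conv_algebra k C R)"
    and regular: "\<And>y. \<lbrakk>y \<in> carrier (conv_algebra k C R);
      x \<otimes>\<^bsub>conv_algebra k C R\<^esub> y = \<zero>\<^bsub>conv_algebra k C R\<^esub>\<rbrakk> \<Longrightarrow> y = \<zero>\<^bsub>conv_algebra k C R\<^esub>"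
  shows "x \<in> Units (conv_algebra k C R)"
proof -
  let ?E = "conv_algebra k C R"
  interpret E: unital_algebra k ?E by (rule conv_algebra_unital_algebra)
  have pow: "x [^]\<^bsub>?E\<^esub> i \<in> carrier ?E" for i :: nat using x by simp
  then have "x [^]\<^bsub>?E\<^esub> i \<in> linear_maps k C R" for i :: nat by (simp add: conv_algebra_simps)
  from linear_maps_dependent[where p = "\<lambda>i. x [^]\<^bsub>?E\<^esub> i",
      OF field_axioms C_module assms(1) R_module assms(2) this]
  obtain n :: nat and c where nc: "(\<forall>i\<le>n. c i \<in> carrier k) \<and> (\<exists>i\<le>n. c i \<noteq> \<zero>\<^bsub>k\<^esub>) \<and>
      (\<forall>v\<in>carrier C. (\<Oplus>\<^bsub>R\<^esub>i\<in>{..n}. c i \<odot>\<^bsub>R\<^esub> (x [^]\<^bsub>?E\<^esub> i) v) = \<zero>\<^bsub>R\<^esub>)"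
    by (elim exE)
  then have c: "\<And>i. i \<le> n \<Longrightarrow> c i \<in> carrier k" "\<exists>i\<le>n. c i \<noteq> \<zero>\<^bsub>k\<^esub>"
    and rel: "\<forall>v\<in>carrier C. (\<Oplus>\<^bsub>R\<^esub>i\<in>{..n}. c i \<odot>\<^bsub>R\<^esub> (x [^]\<^bsub>?E\<^esub> i) v) = \<zero>\<^bsub>R\<^esub>"
    by simp_all
  have cx: "(\<lambda>i. c i \<odot>\<^bsub>?E\<^esub> (x [^]\<^bsub>?E\<^esub> i)) \<in> {..n} \<rightarrow> carrier ?E"
    using c(1) pow by auto
  have "(\<Oplus>\<^bsub>?E\<^esub>i\<in>{..n}. c i \<odot>\<^bsub>?E\<^esub> (x [^]\<^bsub>?E\<^esub> i)) = \<zero>\<^bsub>?E\<^esub>"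
  proof (rule extensionalityI)
    show "(\<Oplus>\<^bsub>?E\<^esub>i\<in>{..n}. c i \<odot>\<^bsub>?E\<^esub> (x [^]\<^bsub>?E\<^esub> i)) \<in> extensional (carrier C)"
      using E.finsum_closed[OF cx] by (simp add: conv_algebra_simps(1))
    show "\<zero>\<^bsub>?E\<^esub> \<in> extensional (carrier C)" by (simp add: conv_algebra_simps)
    fix v assume v: "v \<in> carrier C"
    have "(\<Oplus>\<^bsub>?E\<^esub>i\<in>{..n}. c i \<odot>\<^bsub>?E\<^esub> (x [^]\<^bsub>?E\<^esub> i)) v
        = (\<Oplus>\<^bsub>R\<^esub>i\<in>{..n}. (c i \<odot>\<^bsub>?E\<^esub> (x [^]\<^bsub>?E\<^esub> i)) v)"
      by (rule linear_maps_finsum[OF E.module_axioms R_module evaluation_linear[OF v] _ cx]) simp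
    also have "\<dots> = \<zero>\<^bsub>R\<^esub>" using bspec[OF rel v] v by (simp add: conv_algebra_simps(4,6))
    finally show "(\<Oplus>\<^bsub>?E\<^esub>i\<in>{..n}. c i \<odot>\<^bsub>?E\<^esub> (x [^]\<^bsub>?E\<^esub> i)) v = \<zero>\<^bsub>?E\<^esub> v"
      using v by (simp add: conv_algebra_simps)
  qed
  from E.regular_algebraic_unit[OF x regular c this] show ?thesis .
qed

section \<open>Coverings\<close>

lemma tensor_coalgebra_simps:
  "carrier (tensor_coalgebra k B C) = carrier (tensor_module k B C)"
  "comult (tensor_coalgebra k B C) =
    tensor_lift k (tensor_module k (tensor_module k B C) (tensor_module k B C)) (\<lambda>b c.
      sweedler k B (tensor_module k (tensor_module k B C) (tensor_module k B C)) (\<lambda>x y.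
        sweedler k C (tensor_module k (tensor_module k B C) (tensor_module k B C)) (\<lambda>u v.
          tensor k (tensor_module k B C) (tensor_module k B C)
            (tensor k B C x u) (tensor k B C y v)) c) b)"
  by (simp_all add: tensor_coalgebra_def Let_def module.defs coalgebra.defs)

locale covering_data = B: hopf_algebra k B + A: bialgebra k A + C: coalgebra k C
  for k :: "('k, 'm) ring_scheme" and B :: "('k, 'b, 'x) coalgebra_scheme"
    and A :: "('k, 'a, 'y) coalgebra_scheme" and C :: "('k, 'c, 'z) coalgebra_scheme" +
  fixes f :: "('b \<times> 'c \<Rightarrow> 'k) set \<Rightarrow> 'a"
  assumes f_covering: "covering k B C A f"
begin

abbreviation "BC \<equiv> tensor_module k B C"
abbreviation "Hom_CA \<equiv> conv_algebra k C A"

sublocale CA: convolution k C A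
  by unfold_locales

lemma BC_module: "module k BC"
  by (rule tensor_module_is_module[OF B.C_module C.C_module])

lemma f_linear: "f \<in> linear_maps k BC A"
  using f_covering by (simp add: covering_def partial_covering_def measuring_def)

lemma pure_bilinear: "tensor k B C \<in> bilinear_maps k B C BC"
  by (rule tensor_bilinear[OF B.C_module C.C_module])

lemma f_pure_linear: "b \<in> carrier B \<Longrightarrow> (\<lambda>c. f (tensor k B C b c)) \<in> linear_maps k C A"
  by (rule linear_maps_compose[OF bilinear_mapsD(1)[OF pure_bilinear] f_linear])

lemma f_pure_closed: "\<lbrakk>b \<in> carrier B; c \<in> carrier C\<rbrakk> \<Longrightarrow> f (tensor k B C b c) \<in> carrier A"
  using linear_mapsD(1)[OF f_pure_linear] .

lemma f_comult:
  "t \<in> carrier BC \<Longrightarrow> comult A (f t) = tensor_map k A A f f (comult (tensor_coalgebra k B C) t)"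
  using f_covering
  by (simp add: covering_def partial_covering_def coalgebra_map_def tensor_coalgebra_simps(1))

text \<open>The comultiplication of \<open>B \<otimes> C\<close> on a pure tensor is the expected Sweedler sum; the point to
  check is that the summand is bilinear in \<open>b\<close> and \<open>c\<close>.\<close>

lemma tensor_coalgebra_comult:
  assumes "b \<in> carrier B" "c \<in> carrier C"
  shows "comult (tensor_coalgebra k B C) (tensor k B C b c) =
    sweedler k B (tensor_module k BC BC) (\<lambda>x y. sweedler k C (tensor_module k BC BC)
      (\<lambda>u v. tensor k BC BC (tensor k B C x u) (tensor k B C y v)) c) b"
    and "(\<lambda>x y. sweedler k C (tensor_module k BC BC)
      (\<lambda>u v. tensor k BC BC (tensor k B C x u) (tensor k B C y v)) c)
      \<in> bilinear_maps k B B (tensor_module k BC BC)"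
    and "\<lbrakk>x \<in> carrier B; y \<in> carrier B\<rbrakk> \<Longrightarrow>
      (\<lambda>u v. tensor k BC BC (tensor k B C x u) (tensor k B C y v))
        \<in> bilinear_maps k C C (tensor_module k BC BC)"
proof -
  let ?TT = "tensor_module k BC BC"
  note TT = tensor_module_is_module[OF BC_module BC_module]
  note bTT = tensor_bilinear[OF BC_module BC_module]
  note p1 = bilinear_mapsD(1)[OF pure_bilinear] and p2 = bilinear_mapsD(2)[OF pure_bilinear]
  note pc = bilinear_mapsD(3)[OF pure_bilinear]
  have inner: "(\<lambda>u v. tensor k BC BC (tensor k B C x u) (tensor k B C y v)) \<in> bilinear_maps k C C ?TT"
    if "x \<in> carrier B" "y \<in> carrier B" for x y
    using bilinear_maps_compose[OF bTT p1[OF that(1)] p1[OF that(2)] linear_maps_id] .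
  let ?\<delta> = "\<lambda>c x y. sweedler k C ?TT (\<lambda>u v. tensor k BC BC (tensor k B C x u) (tensor k B C y v)) c"
  have outer: "?\<delta> c \<in> bilinear_maps k B B ?TT" if c: "c \<in> carrier C" for c
  proof (rule bilinear_mapsI)
    fix x assume x: "x \<in> carrier B"
    show "?\<delta> c x \<in> linear_maps k B ?TT"
      by (rule C.sweedler_parameter_linear[OF TT c])
        (rule linear_maps_compose[OF p2 bilinear_mapsD(1)[OF bTT pc[OF x]]])
    show "(\<lambda>y. ?\<delta> c y x) \<in> linear_maps k B ?TT"
      by (rule C.sweedler_parameter_linear[OF TT c])
        (rule linear_maps_compose[OF p2 bilinear_mapsD(2)[OF bTT pc[OF x]]])
  qed
  have "(\<lambda>b c. sweedler k B ?TT (?\<delta> c) b) \<in> bilinear_maps k B C ?TT"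
  proof (rule bilinear_mapsI)
    fix b assume b: "b \<in> carrier B"
    show "(\<lambda>c. sweedler k B ?TT (?\<delta> c) b) \<in> linear_maps k C ?TT"
      by (rule B.sweedler_parameter_linear[OF TT b]) (rule C.sweedler_linear[OF TT inner])
  next
    fix c assume c: "c \<in> carrier C"
    show "(\<lambda>b. sweedler k B ?TT (?\<delta> c) b) \<in> linear_maps k B ?TT"
      using B.sweedler_linear[OF TT outer[OF c]] .
  qed
  from tensor_lift_tensor[OF B.C_module C.C_module TT this assms]
  show "comult (tensor_coalgebra k B C) (tensor k B C b c) = sweedler k B ?TT (?\<delta> c) b"
    unfolding tensor_coalgebra_simps(2) .
  show "?\<delta> c \<in> bilinear_maps k B B ?TT" by (rule outer[OF assms(2)])
  show "(\<lambda>u v. tensor k BC BC (tensor k B C x u) (tensor k B C y v)) \<in> bilinear_maps k C C ?TT"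
    if "x \<in> carrier B" "y \<in> carrier B" by (rule inner[OF that])
qed

text \<open>Composition with \<open>f\<close>, curried. With values in \<open>Hom(B, Hom(C, A))\<close> instead of \<open>Hom(B \<otimes> C, A)\<close>, the
  target is an iterated convolution algebra, whose associativity comes from that of the algebra
  \<open>A\<close> and from the coassociativity of \<open>B\<close> and \<open>C\<close> separately.\<close>

definition pullback :: "('a \<Rightarrow> 'a) \<Rightarrow> 'b \<Rightarrow> 'c \<Rightarrow> 'a"
  where "pullback g = (\<lambda>b\<in>carrier B. \<lambda>c\<in>carrier C. g (f (tensor k B C b c)))"

sublocale BCA: convolution k B Hom_CA
  by (intro convolution.intro B.coalgebra_axioms CA.conv_algebra_unital_algebra)

sublocale AA: convolution k A A
  by unfold_locales

lemma pullback_linear: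
  assumes "g \<in> linear_maps k A A"
  shows "pullback g \<in> linear_maps k B Hom_CA"
proof (rule linear_mapsI)
  note gf = linear_maps_compose[OF f_linear assms]
  note p2 = linear_mapsD[OF linear_maps_compose[OF bilinear_mapsD(2)[OF pure_bilinear] gf]]
  fix b assume b: "b \<in> carrier B"
  show "pullback g b \<in> carrier Hom_CA"
    using linear_maps_compose[OF f_pure_linear[OF b] assms] b
    by (simp add: pullback_def conv_algebra_simps restrict_linear[OF C.C_module])
  fix a assume "a \<in> carrier k"
  with b show "pullback g (a \<odot>\<^bsub>B\<^esub> b) = a \<odot>\<^bsub>Hom_CA\<^esub> pullback g b"
    by (auto simp: pullback_def conv_algebra_simps p2(3) intro!: restrict_ext)
next
  note gf = linear_maps_compose[OF f_linear assms]
  note p2 = linear_mapsD[OF linear_maps_compose[OF bilinear_mapsD(2)[OF pure_bilinear] gf]]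
  fix b b' assume "b \<in> carrier B" "b' \<in> carrier B"
  then show "pullback g (b \<oplus>\<^bsub>B\<^esub> b') = pullback g b \<oplus>\<^bsub>Hom_CA\<^esub> pullback g b'"
    by (auto simp: pullback_def conv_algebra_simps p2(2) intro!: restrict_ext)
qed

lemma pullback_closed:
  assumes "g \<in> linear_maps k A A"
  shows "pullback g \<in> carrier (conv_algebra k B Hom_CA)"
  using pullback_linear[OF assms] by (simp add: conv_algebra_simps(1) pullback_def)

text \<open>Composition with a coalgebra map respects convolution. On a pure tensor \<open>b \<otimes> c\<close> both sides are
  the double Sweedler sum of \<open>g(f(b\<^sub>1 \<otimes> c\<^sub>1)) h(f(b\<^sub>2 \<otimes> c\<^sub>2))\<close>.\<close>

lemma pullback_mult:
  assumes g: "g \<in> linear_maps k A A" and h: "h \<in> linear_maps k A A"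
  shows "pullback (g \<otimes>\<^bsub>conv_algebra k A A\<^esub> h) = pullback g \<otimes>\<^bsub>conv_algebra k B Hom_CA\<^esub> pullback h"
proof -
  let ?TT = "tensor_module k BC BC"
  note TT = tensor_module_is_module[OF BC_module BC_module]
  note AAm = tensor_module_is_module[OF A.C_module A.C_module]
  note gh = AA.product_bilinear[OF g h]
  note pc = bilinear_mapsD(3)[OF pure_bilinear]
  \<comment> \<open>\<open>?H\<close> is the linear map \<open>s \<otimes> t \<mapsto> g(f(s)) h(f(t))\<close>.\<close>
  let ?H = "\<lambda>s. tensor_lift k A (\<lambda>x y. g x \<otimes>\<^bsub>A\<^esub> h y) (tensor_map k A A f f s)"
  have ff: "(\<lambda>v w. tensor k A A (f v) (f w)) \<in> bilinear_maps k BC BC (tensor_module k A A)"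
    using bilinear_maps_compose[OF tensor_bilinear[OF A.C_module A.C_module] f_linear f_linear
        linear_maps_id] .
  have H: "?H \<in> linear_maps k ?TT A"
    unfolding tensor_map_def
    by (rule linear_maps_compose[OF tensor_lift_linear[OF BC_module BC_module AAm ff]
          tensor_lift_linear[OF A.C_module A.C_module A.C_module gh]])
  have Ht: "?H (tensor k BC BC s t) = g (f s) \<otimes>\<^bsub>A\<^esub> h (f t)"
    if "s \<in> carrier BC" "t \<in> carrier BC" for s t
    unfolding tensor_map_def
    using that linear_mapsD(1)[OF f_linear]
    by (simp add: tensor_lift_tensor[OF BC_module BC_module AAm ff]
        tensor_lift_tensor[OF A.C_module A.C_module A.C_module gh])
  have eq: "(g \<otimes>\<^bsub>conv_algebra k A A\<^esub> h) (f (tensor k B C b c))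
      = (pullback g \<otimes>\<^bsub>conv_algebra k B Hom_CA\<^esub> pullback h) b c"
    if b: "b \<in> carrier B" and c: "c \<in> carrier C" for b c
  proof -
    note tc = tensor_coalgebra_comult[OF b c]
    have gc: "g (f (tensor k B C x u)) \<in> carrier A" "h (f (tensor k B C x u)) \<in> carrier A"
      if "x \<in> carrier B" "u \<in> carrier C" for x u
      using that f_pure_closed linear_mapsD(1)[OF g] linear_mapsD(1)[OF h] by blast+
    have prod: "(pullback g x \<otimes>\<^bsub>Hom_CA\<^esub> pullback h y) c = sweedler k C A
        (\<lambda>u v. g (f (tensor k B C x u)) \<otimes>\<^bsub>A\<^esub> h (f (tensor k B C y v))) c"
      if "x \<in> carrier B" "y \<in> carrier B" for x y
      unfolding conv_algebra_simps(2) restrict_apply'[OF c]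
      by (rule C.sweedler_cong[OF A.C_module c]) (use that gc in \<open>simp_all add: pullback_def\<close>)
    have "(g \<otimes>\<^bsub>conv_algebra k A A\<^esub> h) (f (tensor k B C b c))
        = ?H (comult (tensor_coalgebra k B C) (tensor k B C b c))"
      using f_pure_closed[OF b c] f_comult[OF pc[OF b c]]
      by (simp add: conv_algebra_simps(2) sweedler_def)
    also have "\<dots> = sweedler k B A (\<lambda>x y. ?H (sweedler k C ?TT
        (\<lambda>u v. tensor k BC BC (tensor k B C x u) (tensor k B C y v)) c)) b"
      unfolding tc(1) by (rule B.sweedler_compose[OF TT A.C_module tc(2) H b])
    also have "\<dots> = sweedler k B A (\<lambda>x y. (pullback g x \<otimes>\<^bsub>Hom_CA\<^esub> pullback h y) c) b"
    proof (rule B.sweedler_cong[OF A.C_module b])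
      fix x y assume x: "x \<in> carrier B" and y: "y \<in> carrier B"
      have "?H (sweedler k C ?TT (\<lambda>u v. tensor k BC BC (tensor k B C x u) (tensor k B C y v)) c)
          = sweedler k C A (\<lambda>u v. ?H (tensor k BC BC (tensor k B C x u) (tensor k B C y v))) c"
        by (rule C.sweedler_compose[OF TT A.C_module tc(3)[OF x y] H c])
      also have "\<dots> = sweedler k C A
          (\<lambda>u v. g (f (tensor k B C x u)) \<otimes>\<^bsub>A\<^esub> h (f (tensor k B C y v))) c"
        by (rule C.sweedler_cong[OF A.C_module c]) (use x y gc in \<open>simp_all add: Ht pc\<close>)
      finally show "?H (sweedler k C ?TT
          (\<lambda>u v. tensor k BC BC (tensor k B C x u) (tensor k B C y v)) c)
          = (pullback g x \<otimes>\<^bsub>Hom_CA\<^esub> pullback h y) c"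
        using prod[OF x y] by simp
      show "(pullback g x \<otimes>\<^bsub>Hom_CA\<^esub> pullback h y) c \<in> carrier A"
        using linear_mapsD(1)[OF CA.evaluation_linear[OF c]]
          bilinear_mapsD(3)[OF CA.conv_algebra_mult_bilinear]
          linear_mapsD(1)[OF pullback_linear[OF g] x] linear_mapsD(1)[OF pullback_linear[OF h] y]
        by blast
    qed
    also have "\<dots> = (sweedler k B Hom_CA (\<lambda>x y. pullback g x \<otimes>\<^bsub>Hom_CA\<^esub> pullback h y) b) c"
      by (rule B.sweedler_compose[OF CA.conv_algebra_module A.C_module
            BCA.product_bilinear[OF pullback_linear[OF g] pullback_linear[OF h]]
            CA.evaluation_linear[OF c] b, symmetric])
    also have "\<dots> = (pullback g \<otimes>\<^bsub>conv_algebra k B Hom_CA\<^esub> pullback h) b c"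
      using b by (simp add: conv_algebra_simps(2))
    finally show ?thesis .
  qed
  have "(pullback g \<otimes>\<^bsub>conv_algebra k B Hom_CA\<^esub> pullback h) b \<in> extensional (carrier C)"
    if "b \<in> carrier B" for b
  proof -
    have "pullback g \<otimes>\<^bsub>conv_algebra k B Hom_CA\<^esub> pullback h \<in> linear_maps k B Hom_CA"
      using BCA.conv_algebra_mult_closed[OF pullback_linear[OF g] pullback_linear[OF h]]
      unfolding conv_algebra_simps(1)[of k B] by blast
    from linear_mapsD(1)[OF this that] show ?thesis by (simp add: conv_algebra_simps(1))
  qed
  then have "pullback (g \<otimes>\<^bsub>conv_algebra k A A\<^esub> h) b
      = (pullback g \<otimes>\<^bsub>conv_algebra k B Hom_CA\<^esub> pullback h) b" if "b \<in> carrier B" for b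
    using that eq[OF that] by (intro extensionalityI[of _ "carrier C"]) (simp_all add: pullback_def)
  moreover have "pullback g \<otimes>\<^bsub>conv_algebra k B Hom_CA\<^esub> pullback h \<in> extensional (carrier B)"
    by (simp add: conv_algebra_simps(2))
  ultimately show ?thesis
    by (intro extensionalityI[of _ "carrier B"]) (simp_all add: pullback_def)
qed

text \<open>Surjectivity of \<open>f\<close> makes pulling back injective.\<close>

lemma pullback_zero_iff:
  assumes h: "h \<in> carrier (conv_algebra k A A)"
  shows "pullback h = \<zero>\<^bsub>conv_algebra k B Hom_CA\<^esub> \<longleftrightarrow> h = \<zero>\<^bsub>conv_algebra k A A\<^esub>"
proof
  assume zero: "pullback h = \<zero>\<^bsub>conv_algebra k B Hom_CA\<^esub>"
  have hl: "h \<in> linear_maps k A A" using h by (simp add: conv_algebra_simps)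
  have "h (f (tensor k B C b c)) = \<zero>\<^bsub>A\<^esub>" if "b \<in> carrier B" "c \<in> carrier C" for b c
    using fun_cong[OF fun_cong[OF zero, of b], of c] that
    by (simp add: pullback_def conv_algebra_simps)
  then have hf: "h (f t) = \<zero>\<^bsub>A\<^esub>" if "t \<in> carrier BC" for t
    using linear_maps_eq_on_tensors[OF B.C_module C.C_module A.C_module
        linear_maps_compose[OF f_linear hl] linear_maps_const_zero[OF A.C_module] _ that] by simp
  have "h a = \<zero>\<^bsub>A\<^esub>" if "a \<in> carrier A" for a
  proof -
    have "a \<in> f ` carrier BC" using f_covering that by (simp add: covering_def)
    then show ?thesis using hf by blast
  qed
  then show "h = \<zero>\<^bsub>conv_algebra k A A\<^esub>"
    using h by (intro extensionalityI[of _ "carrier A"]) (simp_all add: conv_algebra_simps)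
next
  assume "h = \<zero>\<^bsub>conv_algebra k A A\<^esub>"
  then show "pullback h = \<zero>\<^bsub>conv_algebra k B Hom_CA\<^esub>"
    by (auto simp: pullback_def conv_algebra_simps f_pure_closed intro!: restrict_ext)
qed

text \<open>The measuring axioms say that \<open>f\<close>, curried, is an algebra map from \<open>B\<close> to the convolution
  algebra \<open>Hom(C, A)\<close>. This curried map is the pullback of the identity of \<open>A\<close>.\<close>

lemma pullback_id_unit: "pullback (\<lambda>a\<in>carrier A. a) \<in> Units (conv_algebra k B Hom_CA)"
proof -
  let ?F = "\<lambda>b. \<lambda>c\<in>carrier C. f (tensor k B C b c)"
  have F: "restrict ?F (carrier B) = pullback (\<lambda>a. a)" by (simp add: pullback_def)
  have "restrict ?F (carrier B) \<in> Units (conv_algebra k B Hom_CA)"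
  proof (rule hopf_algebra_map_unit[OF B.hopf_algebra_axioms CA.conv_algebra_unital_algebra])
    show "?F \<in> linear_maps k B Hom_CA"
      using pullback_linear[OF linear_maps_id] unfolding F[symmetric]
      by (simp only: restrict_linear[OF B.C_module])
    show "?F \<one>\<^bsub>B\<^esub> = \<one>\<^bsub>Hom_CA\<^esub>"
      using f_covering
      by (auto simp: covering_def partial_covering_def measuring_def conv_algebra_simps
          intro!: restrict_ext)
    fix x y assume x: "x \<in> carrier B" and y: "y \<in> carrier B"
    show "?F (x \<otimes>\<^bsub>B\<^esub> y) = ?F x \<otimes>\<^bsub>Hom_CA\<^esub> ?F y"
      unfolding conv_algebra_simps(2)
    proof (rule restrict_ext)
      fix c assume c: "c \<in> carrier C"
      have "f (tensor k B C (x \<otimes>\<^bsub>B\<^esub> y) c)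
          = sweedler k C A (\<lambda>u v. f (tensor k B C x u) \<otimes>\<^bsub>A\<^esub> f (tensor k B C y v)) c"
        using f_covering x y c by (simp add: covering_def partial_covering_def measuring_def)
      also have "\<dots> = sweedler k C A (\<lambda>u v. ?F x u \<otimes>\<^bsub>A\<^esub> ?F y v) c"
        by (rule C.sweedler_cong[OF A.C_module c]) (use x y f_pure_closed in simp_all)
      finally show "f (tensor k B C (x \<otimes>\<^bsub>B\<^esub> y) c)
          = sweedler k C A (\<lambda>u v. ?F x u \<otimes>\<^bsub>A\<^esub> ?F y v) c" .
    qed
  qed
  moreover have "pullback (\<lambda>a\<in>carrier A. a) = restrict ?F (carrier B)"
    by (auto simp: pullback_def f_pure_closed intro!: restrict_ext)
  ultimately show ?thesis by simp
qed

text \<open>If \<open>id * h = 0\<close> in \<open>Hom(A, A)\<close>, pulling back gives \<open>f * (h \<circ> f) = 0\<close>. Multiplying by the inverse of \<open>f\<close>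
  gives \<open>h \<circ> f = 0\<close>, so \<open>h = 0\<close>. Thus the identity of \<open>A\<close> is left regular, hence invertible, and its
  inverse is the antipode.\<close>

lemma hopf_algebra_of_covering:
  assumes "finite_dimensional k A"
  shows "hopf_algebra k A"
proof -
  let ?D = "conv_algebra k A A" and ?E = "conv_algebra k B Hom_CA"
  let ?id = "\<lambda>a\<in>carrier A. a"
  interpret D: unital_algebra k ?D by (rule AA.conv_algebra_unital_algebra)
  interpret E: unital_algebra k ?E by (rule BCA.conv_algebra_unital_algebra)
  have id_linear: "?id \<in> linear_maps k A A"
    using linear_maps_id by (simp add: restrict_linear[OF A.C_module])
  then have id: "?id \<in> carrier ?D" by (simp add: conv_algebra_simps)
  have "?id \<in> Units ?D"
  proof (rule AA.regular_conv_unit[OF assms assms id])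
    fix h assume h: "h \<in> carrier ?D" and zero: "?id \<otimes>\<^bsub>?D\<^esub> h = \<zero>\<^bsub>?D\<^esub>"
    have hl: "h \<in> linear_maps k A A" using h by (simp add: conv_algebra_simps)
    have "\<zero>\<^bsub>?D\<^esub> \<in> carrier ?D" by (rule D.M.zero_closed)
    then have "pullback ?id \<otimes>\<^bsub>?E\<^esub> pullback h = \<zero>\<^bsub>?E\<^esub>"
      using pullback_mult[OF id_linear hl] pullback_zero_iff zero by metis
    moreover obtain r where r: "r \<in> carrier ?E" "r \<otimes>\<^bsub>?E\<^esub> pullback ?id = \<one>\<^bsub>?E\<^esub>"
      using pullback_id_unit unfolding Units_def by blast
    moreover have pc: "pullback ?id \<in> carrier ?E" "pullback h \<in> carrier ?E"
      using pullback_closed id_linear hl by blast+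
    moreover have "pullback h = (r \<otimes>\<^bsub>?E\<^esub> pullback ?id) \<otimes>\<^bsub>?E\<^esub> pullback h"
      using pc r by simp
    ultimately have "pullback h = r \<otimes>\<^bsub>?E\<^esub> \<zero>\<^bsub>?E\<^esub>"
      using E.m_assoc by metis
    then have "pullback h = \<zero>\<^bsub>?E\<^esub>" using r(1) by simp
    then show "h = \<zero>\<^bsub>?D\<^esub>" using pullback_zero_iff[OF h] by simp
  qed
  then obtain S where S: "S \<in> carrier ?D" "S \<otimes>\<^bsub>?D\<^esub> ?id = \<one>\<^bsub>?D\<^esub>" "?id \<otimes>\<^bsub>?D\<^esub> S = \<one>\<^bsub>?D\<^esub>"
    unfolding Units_def by blast
  have Sl: "S \<in> linear_maps k A A" using S(1) by (simp add: conv_algebra_simps)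
  have "antipode k A S"
    unfolding antipode_def
  proof (intro conjI ballI Sl)
    fix a assume a: "a \<in> carrier A"
    have "sweedler k A A (\<lambda>x y. S x \<otimes>\<^bsub>A\<^esub> y) a = (S \<otimes>\<^bsub>?D\<^esub> ?id) a"
      using a linear_mapsD(1)[OF Sl]
      by (simp add: conv_algebra_simps(2) A.sweedler_cong[OF A.C_module a])
    then show "sweedler k A A (\<lambda>x y. S x \<otimes>\<^bsub>A\<^esub> y) a = counit A a \<odot>\<^bsub>A\<^esub> \<one>\<^bsub>A\<^esub>"
      using S(2) a by (simp add: conv_algebra_simps(3))
    have "sweedler k A A (\<lambda>x y. x \<otimes>\<^bsub>A\<^esub> S y) a = (?id \<otimes>\<^bsub>?D\<^esub> S) a"
      using a linear_mapsD(1)[OF Sl]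
      by (simp add: conv_algebra_simps(2) A.sweedler_cong[OF A.C_module a])
    then show "sweedler k A A (\<lambda>x y. x \<otimes>\<^bsub>A\<^esub> S y) a = counit A a \<odot>\<^bsub>A\<^esub> \<one>\<^bsub>A\<^esub>"
      using S(3) a by (simp add: conv_algebra_simps(3))
  qed
  then show ?thesis
    by (intro hopf_algebra.intro A.bialgebra_axioms hopf_algebra_axioms.intro) blast
qed

end

theorem theorem4p1:
  fixes k :: "('k, 'm) ring_scheme"
    and B :: "('k, 'b, 'x) coalgebra_scheme"
    and A :: "('k, 'a, 'y) coalgebra_scheme"
  assumes "field k"
    and "hopf_algebra k B"
    and "bialgebra k A"
    and "finite_dimensional k A"
    and "\<exists>(C :: ('k, 'c, 'z) coalgebra_scheme) f. coalgebra k C \<and> covering k B C A f"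
  shows "hopf_algebra k A"
proof -
  obtain C :: "('k, 'c, 'z) coalgebra_scheme" and f where "coalgebra k C" "covering k B C A f"
    using assms(5) by blast
  then have "covering_data k B A C f"
    by (intro covering_data.intro covering_data_axioms.intro assms)
  from covering_data.hopf_algebra_of_covering[OF this assms(4)] show ?thesis .
qed

end
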